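(* Let $\Omega\subset\mathbb{C}^n$ be a bounded pseudoconvex domain with smooth boundary and let $\delta$ be its signed distance function. For $t>0$ let $r_t=\delta e^{-t|z|^2}$. Then for every $t>0$ there exist an interior neighborhood $V$ of $\partial\Omega$ (that is, $V=W\cap\Omega$ with $W$ an open neighborhood of $\partial\Omega$) and a constant $c_0<0$ such that for every $c\in(c_0,0)$ the level set $\{z\in V:\ r_t(z)=c\}$ is strongly pseudoconvex.
   Context: The signed distance function is $\delta(x)=\operatorname{dist}(x,\partial\Omega)$ for $x\in\Omega^c$ and $\delta(x)=-\operatorname{dist}(x,\partial\Omega)$ for $x\in\Omega$; it is smooth near $\partial\Omega$. $\Omega$ is pseudoconvex if $\operatorname{Hess}_\delta(L_p,L_p)\ge0$ for all $p\in\partial\Omega$ and all $L_p\in T^{1,0}_p(\partial\Omega)$, equivalently if $-\log(-\delta)$ is plurisubharmonic in $\Omega$. Here $\operatorname{Hess}_f(X,X)=\sum_{i,j}\frac{\partial^2f}{\partial z^i\partial\bar z^j}X^i\overline{X^j}$ for $X=\sum_iX^i\partial/\partial z^i$ is the complex Hessian. A level set $\{r_t=c\}$ in the region where $r_t$ is smooth with $dr_t\neq0$ is strongly pseudoconvex if its Levi form is positive definite: $\operatorname{Hess}_{r_t}(X,X)>0$ at each of its points for every nonzero $(1,0)$ vector $X$ with $Xr_t=0$. *)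

theory Defs
  imports "HOL-Analysis.Analysis"
begin

text \<open>\<open>Ck_on k S f\<close> is meant for open \<open>S\<close>: all iterated directional derivatives of \<open>f\<close>
  of order at most \<open>k\<close> exist and are continuous on \<open>S\<close>, and those of order less than \<open>k\<close>
  are (totally) differentiable there.\<close>

primrec Ck_on :: "nat \<Rightarrow> 'a::euclidean_space set \<Rightarrow> ('a \<Rightarrow> real) \<Rightarrow> bool" where
  "Ck_on 0 S f \<longleftrightarrow> continuous_on S f"
| "Ck_on (Suc k) S f \<longleftrightarrow>
     (\<forall>x\<in>S. f differentiable (at x)) \<and>
     (\<forall>v. Ck_on k S (\<lambda>x. frechet_derivative f (at x) v))"

definition smooth_on :: "'a::euclidean_space set \<Rightarrow> ('a \<Rightarrow> real) \<Rightarrow> bool" where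
  "smooth_on S f \<longleftrightarrow> open S \<and> (\<forall>k. Ck_on k S f)"

definition regular_at :: "('a::euclidean_space \<Rightarrow> real) \<Rightarrow> 'a \<Rightarrow> bool" where
  "regular_at f p \<longleftrightarrow> f differentiable (at p) \<and> frechet_derivative f (at p) \<noteq> (\<lambda>v. 0)"

definition smooth_boundary :: "'a::euclidean_space set \<Rightarrow> bool" where
  "smooth_boundary \<Omega> \<longleftrightarrow>
     (\<forall>p\<in>frontier \<Omega>. \<exists>U \<rho>. p \<in> U \<and> smooth_on U \<rho> \<and> (\<forall>z\<in>U. regular_at \<rho> z) \<and>
        \<Omega> \<inter> U = {z\<in>U. \<rho> z < 0})"

definition signed_dist :: "'a::metric_space set \<Rightarrow> 'a \<Rightarrow> real" where
  "signed_dist \<Omega> x =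
     (if x \<in> \<Omega> then - infdist x (frontier \<Omega>) else infdist x (frontier \<Omega>))"

text \<open>The Wirtinger derivatives \<open>\<partial>/\<partial>z\<^sup>i = (\<partial>/\<partial>x\<^sup>i - \<i> \<partial>/\<partial>y\<^sup>i)/2\<close> and
  \<open>\<partial>/\<partial>\<bar>z\<^sup>i = (\<partial>/\<partial>x\<^sup>i + \<i> \<partial>/\<partial>y\<^sup>i)/2\<close>: \<open>axis i 1\<close> is the \<open>x\<^sup>i\<close> direction
  and \<open>axis i \<i>\<close> the \<open>y\<^sup>i\<close> direction. The derivatives are over the reals.\<close>

definition d_z :: "'n \<Rightarrow> (complex ^ 'n::finite \<Rightarrow> complex) \<Rightarrow> complex ^ 'n \<Rightarrow> complex" where
  "d_z i f p = (frechet_derivative f (at p) (axis i 1)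
                 - \<i> * frechet_derivative f (at p) (axis i \<i>)) / 2"

definition d_zbar :: "'n \<Rightarrow> (complex ^ 'n::finite \<Rightarrow> complex) \<Rightarrow> complex ^ 'n \<Rightarrow> complex" where
  "d_zbar i f p = (frechet_derivative f (at p) (axis i 1)
                    + \<i> * frechet_derivative f (at p) (axis i \<i>)) / 2"

text \<open>A vector \<open>X\<close> stands for the (1,0) vector \<open>\<Sum>i. X\<^sup>i \<partial>/\<partial>z\<^sup>i\<close>.\<close>

definition apply_10 ::
    "complex ^ 'n::finite \<Rightarrow> (complex ^ 'n \<Rightarrow> real) \<Rightarrow> complex ^ 'n \<Rightarrow> complex" where
  "apply_10 X f p = (\<Sum>i\<in>UNIV. X $ i * d_z i (\<lambda>z. of_real (f z)) p)"

definition complex_Hess ::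
    "(complex ^ 'n::finite \<Rightarrow> real) \<Rightarrow> complex ^ 'n \<Rightarrow> complex ^ 'n \<Rightarrow> complex" where
  "complex_Hess f p X =
     (\<Sum>i\<in>UNIV. \<Sum>j\<in>UNIV. d_z i (d_zbar j (\<lambda>z. of_real (f z))) p * X $ i * cnj (X $ j))"

text \<open>The complex Hessian of a real function is Hermitian wherever the function is twice
  continuously differentiable, so taking real parts below loses nothing. The tangent space
  \<open>T\<^sup>1\<^sup>,\<^sup>0\<close> of the boundary is the kernel of \<open>X \<mapsto> X\<delta>\<close>, as \<open>\<delta>\<close> is a defining function.\<close>

definition pseudoconvex :: "(complex ^ 'n::finite) set \<Rightarrow> bool" where
  "pseudoconvex \<Omega> \<longleftrightarrow>
     (\<forall>p\<in>frontier \<Omega>. \<forall>L. apply_10 L (signed_dist \<Omega>) p = 0 \<longrightarrow>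
        Re (complex_Hess (signed_dist \<Omega>) p L) \<ge> 0)"

text \<open>The level set of \<open>r\<close> in \<open>V\<close> at height \<open>c\<close>. Lying in the region where \<open>r\<close> is smooth and
  regular is part of the notion.\<close>

definition strongly_pseudoconvex_level_set ::
    "(complex ^ 'n::finite) set \<Rightarrow> (complex ^ 'n \<Rightarrow> real) \<Rightarrow> real \<Rightarrow> bool" where
  "strongly_pseudoconvex_level_set V r c \<longleftrightarrow>
     (\<forall>z\<in>V. r z = c \<longrightarrow>
        (\<exists>U. z \<in> U \<and> smooth_on U r) \<and> regular_at r z \<and>
        (\<forall>X. X \<noteq> 0 \<and> apply_10 X r z = 0 \<longrightarrow> Re (complex_Hess r z X) > 0))"

end

theory Submission
  imports Defs
begin

text \<open>
  Write \<open>\<delta>\<close> for the signed distance and \<open>r = \<delta> e\<^bsup>-t|z|\<^sup>2\<^esup>\<close>. Inside the domain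
  \<open>-log(-r) = -log(-\<delta>) + t|z|\<^sup>2\<close>. By Oka's lemma the first summand is plurisubharmonic near the
  boundary of a pseudoconvex domain and the second is strictly plurisubharmonic. On vectors tangent to
  a level set of \<open>r\<close> the complex Hessian of \<open>-log(-r)\<close> is that of \<open>r\<close> divided by \<open>-r > 0\<close>, so every
  regular level set of \<open>r\<close> close to the boundary is strongly pseudoconvex, for every \<open>t > 0\<close>.

  Oka's lemma is used in the form \<open>Hess\<^sub>\<delta>(w, w) \<ge> |w\<delta>|\<^sup>2 / \<delta>\<close> (\<open>oka_inequality\<close>). It is
  derived from the Lipschitz property of \<open>\<delta>\<close>: restricted to a complex line through an interior point
  \<open>z\<close>, the distance is compared with its values on a complex line through the nearest boundary point
  \<open>z0\<close>. The comparison is an equality at \<open>z\<close>, so the second derivative test turns it into an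
  inequality between Laplacians, and the second line can be chosen tangent to the boundary at \<open>z0\<close>,
  where the Levi form is nonnegative by hypothesis.

  For this \<open>\<delta>\<close> has to be smooth near the boundary (\<open>signed_dist_smooth_near_boundary\<close>). The nearest
  boundary point and the normal coordinate of a point are the values of a local inverse of a smooth map
  built from a local defining function, and the inverse function theorem is upgraded to all orders of
  differentiability by \<open>smooth_local_inverse\<close>.
\<close>

section \<open>Calculus of \<open>C\<^sup>k\<close> maps\<close>

text \<open>The same recursion as \<open>Ck_on\<close>, for an arbitrary normed codomain: the regularity
  of an inverse map is that of an operator-valued function, its derivative, so real-valued functions
  do not suffice.\<close>

primrec Ck_map :: "nat \<Rightarrow> 'a::real_normed_vector set \<Rightarrow> ('a \<Rightarrow> 'b::real_normed_vector) \<Rightarrow> bool" where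
  "Ck_map 0 S f \<longleftrightarrow> continuous_on S f"
| "Ck_map (Suc k) S f \<longleftrightarrow>
     (\<forall>x\<in>S. f differentiable (at x)) \<and>
     (\<forall>v. Ck_map k S (\<lambda>x. frechet_derivative f (at x) v))"

lemma Ck_map_real: "Ck_map k S f \<longleftrightarrow> Ck_on k S f"
  by (induction k arbitrary: f) auto

lemma Ck_map_cong:
  assumes "open S" "\<And>x. x \<in> S \<Longrightarrow> f x = g x"
  shows "Ck_map k S f \<longleftrightarrow> Ck_map k S g"
  using assms(2)
proof (induction k arbitrary: f g)
  case 0
  then show ?case by (simp cong: continuous_on_cong)
next
  case (Suc k)
  have tr: "(f has_derivative f') (at x) \<longleftrightarrow> (g has_derivative f') (at x)" if "x \<in> S" for x f'
    using has_derivative_transform_within_open[of f f' x UNIV S g]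
      has_derivative_transform_within_open[of g f' x UNIV S f] assms(1) that Suc.prems by auto
  have "frechet_derivative f (at x) = frechet_derivative g (at x)" if "x \<in> S" for x
    using tr[OF that] by (simp add: frechet_derivative_def)
  moreover have "f differentiable (at x) \<longleftrightarrow> g differentiable (at x)" if "x \<in> S" for x
    using tr[OF that] by (simp add: differentiable_def)
  ultimately show ?case
    using Suc.IH[of "\<lambda>x. frechet_derivative f (at x) _" "\<lambda>x. frechet_derivative g (at x) _"]
    by (simp cong: ball_cong)
qed

text \<open>Any family of derivatives will do in place of \<open>frechet_derivative\<close>. In the lemmas
  below the derivative of the function in question is then given by a formula in terms of \<open>C\<^sup>k\<close>
  functions, and the induction on \<open>k\<close> closes.\<close>

lemma Ck_map_SucI:
  assumes "open S"
    and der: "\<And>x. x \<in> S \<Longrightarrow> (f has_derivative f' x) (at x)"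
    and "\<And>v. Ck_map k S (\<lambda>x. f' x v)"
  shows "Ck_map (Suc k) S f"
proof -
  have "Ck_map k S (\<lambda>x. frechet_derivative f (at x) v) \<longleftrightarrow> Ck_map k S (\<lambda>x. f' x v)" for v
    by (intro Ck_map_cong assms(1)) (metis der frechet_derivative_at)
  with assms show ?thesis
    by (auto simp: differentiable_def)
qed

lemma Ck_map_SucE:
  assumes "Ck_map (Suc k) S f"
  obtains f' where "\<And>x. x \<in> S \<Longrightarrow> (f has_derivative f' x) (at x)"
    "\<And>v. Ck_map k S (\<lambda>x. f' x v)"
  using assms frechet_derivative_works by (metis Ck_map.simps(2))

lemma Ck_map_SucD: "Ck_map (Suc k) S f \<Longrightarrow> Ck_map k S f"
proof (induction k arbitrary: f)
  case 0
  then show ?case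
    by (auto intro!: differentiable_imp_continuous_on differentiable_at_imp_differentiable_on)
next
  case (Suc k)
  then show ?case by (metis Ck_map.simps(2))
qed

lemma Ck_map_continuous: "Ck_map k S f \<Longrightarrow> continuous_on S f"
  by (induction k) (auto dest: Ck_map_SucD simp del: Ck_map.simps(2))

lemma Ck_map_subset: "Ck_map k S f \<Longrightarrow> T \<subseteq> S \<Longrightarrow> Ck_map k T f"
  by (induction k arbitrary: f) (auto intro: continuous_on_subset)

lemma Ck_map_const: "Ck_map k S (\<lambda>x. c)"
  by (induction k arbitrary: c) auto

lemma Ck_map_bounded_linear:
  assumes "bounded_linear f" "open S"
  shows "Ck_map k S f"
proof (cases k)
  case 0
  then show ?thesis by (simp add: assms linear_continuous_on)
next
  case (Suc j)
  show ?thesis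
    unfolding Suc by (rule Ck_map_SucI[where f' = "\<lambda>x. f"])
      (auto intro!: Ck_map_const bounded_linear_imp_has_derivative assms)
qed

lemma Ck_map_add:
  assumes "open S" "Ck_map k S f" "Ck_map k S g"
  shows "Ck_map k S (\<lambda>x. f x + g x)"
  using assms(2,3)
proof (induction k arbitrary: f g)
  case (Suc k)
  from Suc.prems obtain f' g' where
    "\<And>x. x \<in> S \<Longrightarrow> (f has_derivative f' x) (at x)" "\<And>v. Ck_map k S (\<lambda>x. f' x v)"
    "\<And>x. x \<in> S \<Longrightarrow> (g has_derivative g' x) (at x)" "\<And>v. Ck_map k S (\<lambda>x. g' x v)"
    by (metis Ck_map_SucE)
  with Suc.IH show ?case
    by (intro Ck_map_SucI[where f' = "\<lambda>x v. f' x v + g' x v"] assms(1)) (auto intro: has_derivative_add)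
qed (auto intro: continuous_on_add)

lemma Ck_map_bilinear:
  assumes bl: "bounded_bilinear B" and "open S" "Ck_map k S f" "Ck_map k S g"
  shows "Ck_map k S (\<lambda>x. B (f x) (g x))"
  using assms(3,4)
proof (induction k arbitrary: f g)
  case 0
  then show ?case by (auto intro: bounded_bilinear.continuous_on[OF bl])
next
  case (Suc k)
  from Suc.prems obtain f' g' where
    "\<And>x. x \<in> S \<Longrightarrow> (f has_derivative f' x) (at x)" "\<And>v. Ck_map k S (\<lambda>x. f' x v)"
    "\<And>x. x \<in> S \<Longrightarrow> (g has_derivative g' x) (at x)" "\<And>v. Ck_map k S (\<lambda>x. g' x v)"
    by (metis Ck_map_SucE)
  moreover have "Ck_map k S f" "Ck_map k S g"
    using Suc.prems by (auto dest: Ck_map_SucD simp del: Ck_map.simps(2))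
  ultimately show ?case
    by (intro Ck_map_SucI[where f' = "\<lambda>x v. B (f x) (g' x v) + B (f' x v) (g x)"] assms(2))
      (auto intro!: bounded_bilinear.FDERIV[OF bl] Ck_map_add[OF assms(2)] Suc.IH)
qed

lemma Ck_map_linear_image:
  assumes L: "bounded_linear L" and "open S" "Ck_map k S f"
  shows "Ck_map k S (\<lambda>x. L (f x))"
  using assms(3)
proof (induction k arbitrary: f)
  case 0
  then show ?case by (auto intro: bounded_linear.continuous_on[OF L])
next
  case (Suc k)
  from Suc.prems obtain f' where
    "\<And>x. x \<in> S \<Longrightarrow> (f has_derivative f' x) (at x)" "\<And>v. Ck_map k S (\<lambda>x. f' x v)"
    by (metis Ck_map_SucE)
  then show ?case
    by (intro Ck_map_SucI[where f' = "\<lambda>x v. L (f' x v)"] assms(2))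
      (auto intro!: bounded_linear.has_derivative[OF L] Suc.IH)
qed

lemma Ck_map_sum:
  assumes "open S" "\<And>i. i \<in> I \<Longrightarrow> Ck_map k S (f i)"
  shows "Ck_map k S (\<lambda>x. \<Sum>i\<in>I. f i x)"
  using assms(2)
  by (induction I rule: infinite_finite_induct) (auto intro!: Ck_map_const Ck_map_add[OF assms(1)])

lemma Ck_map_Pair:
  assumes "open S" "Ck_map k S f" "Ck_map k S g"
  shows "Ck_map k S (\<lambda>x. (f x, g x))"
proof -
  have "Ck_map k S (\<lambda>x. (f x, 0) + (0, g x))"
    by (intro Ck_map_add assms Ck_map_linear_image[of "\<lambda>y. (y, 0)"] Ck_map_linear_image[of "\<lambda>y. (0, y)"]
        bounded_linear_Pair bounded_linear_ident bounded_linear_zero)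
  then show ?thesis by simp
qed

text \<open>The chain rule turns the derivative into \<open>Df(g x)(Dg(x) v)\<close>, where the direction
  depends on \<open>x\<close>. Expanding that direction in a basis leaves sums of products of a \<open>C\<^sup>k\<close> coefficient
  with a composition \<open>Df(_)(b) \<circ> g\<close> in a fixed direction \<open>b\<close>, to which the induction applies.\<close>

lemma Ck_map_compose:
  fixes f :: "'b::euclidean_space \<Rightarrow> 'c::real_normed_vector"
  assumes "open S" and "open T" and "g ` S \<subseteq> T" and "Ck_map k S g" and "Ck_map k T f"
  shows "Ck_map k S (\<lambda>x. f (g x))"
  using assms(4,5)
proof (induction k arbitrary: f)
  case 0
  then show ?case using assms(3) by (auto intro: continuous_on_compose2)
next
  case (Suc k)
  from Suc.prems obtain f' g' where
    f': "\<And>x. x \<in> T \<Longrightarrow> (f has_derivative f' x) (at x)" "\<And>v. Ck_map k T (\<lambda>x. f' x v)" and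
    g': "\<And>x. x \<in> S \<Longrightarrow> (g has_derivative g' x) (at x)" "\<And>v. Ck_map k S (\<lambda>x. g' x v)"
    by (metis Ck_map_SucE)
  have gk: "Ck_map k S g" using Suc.prems(1) by (rule Ck_map_SucD)
  have expand: "f' (g x) (g' x v) = (\<Sum>b\<in>Basis. (g' x v \<bullet> b) *\<^sub>R f' (g x) b)" if "x \<in> S" for x v
  proof -
    have "linear (f' (g x))"
      using f'(1) assms(3) that has_derivative_linear by blast
    then have "f' (g x) (\<Sum>b\<in>Basis. (g' x v \<bullet> b) *\<^sub>R b) = (\<Sum>b\<in>Basis. (g' x v \<bullet> b) *\<^sub>R f' (g x) b)"
      by (simp add: linear_sum linear_cmul)
    then show ?thesis by (simp add: euclidean_representation)
  qed
  show ?case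
  proof (rule Ck_map_SucI[where f' = "\<lambda>x v. f' (g x) (g' x v)"])
    show "((\<lambda>x. f (g x)) has_derivative (\<lambda>v. f' (g x) (g' x v))) (at x)" if "x \<in> S" for x
      using has_derivative_compose[OF g'(1)[OF that] f'(1)] assms(3) that by blast
    show "Ck_map k S (\<lambda>x. f' (g x) (g' x v))" for v
    proof -
      have "Ck_map k S (\<lambda>x. \<Sum>b\<in>Basis. (g' x v \<bullet> b) *\<^sub>R f' (g x) b)"
        by (intro Ck_map_sum assms(1) Ck_map_bilinear[OF bounded_bilinear_scaleR]
            Ck_map_linear_image[OF bounded_linear_inner_left] Suc.IH gk g'(2) f'(2))
      then show ?thesis
        by (subst Ck_map_cong[OF assms(1) expand])
    qed
  qed (rule assms(1))
qed

lemma Ck_map_inverse: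
  fixes f :: "'a::real_normed_vector \<Rightarrow> real"
  assumes "open S" "Ck_map k S f" "\<And>x. x \<in> S \<Longrightarrow> f x \<noteq> 0"
  shows "Ck_map k S (\<lambda>x. inverse (f x))"
  using assms(2,3)
proof (induction k arbitrary: f)
  case 0
  then show ?case by (auto intro: continuous_on_inverse)
next
  case (Suc k)
  from Suc.prems obtain f' where
    f': "\<And>x. x \<in> S \<Longrightarrow> (f has_derivative f' x) (at x)" "\<And>v. Ck_map k S (\<lambda>x. f' x v)"
    by (metis Ck_map_SucE)
  have fk: "Ck_map k S f" using Suc.prems(1) by (rule Ck_map_SucD)
  show ?case
  proof (rule Ck_map_SucI[where f' = "\<lambda>x v. - (inverse (f x) * f' x v * inverse (f x))"])
    show "((\<lambda>x. inverse (f x)) has_derivative (\<lambda>v. - (inverse (f x) * f' x v * inverse (f x)))) (at x)"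
      if "x \<in> S" for x
      using Deriv.has_derivative_inverse[OF Suc.prems(2) f'(1)] that by blast
    show "Ck_map k S (\<lambda>x. - (inverse (f x) * f' x v * inverse (f x)))" for v
      by (intro Ck_map_linear_image[where L = uminus] Ck_map_bilinear[OF bounded_bilinear_mult] Suc.IH
          f' fk Suc.prems(2) bounded_linear_minus bounded_linear_ident assms(1))
  qed (rule assms(1))
qed

lemma Ck_map_sqrt:
  fixes f :: "'a::real_normed_vector \<Rightarrow> real"
  assumes "open S" "Ck_map k S f" "\<And>x. x \<in> S \<Longrightarrow> f x > 0"
  shows "Ck_map k S (\<lambda>x. sqrt (f x))"
  using assms(2,3)
proof (induction k arbitrary: f)
  case 0
  then show ?case by (auto intro: continuous_on_real_sqrt)
next
  case (Suc k)
  from Suc.prems obtain f' where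
    f': "\<And>x. x \<in> S \<Longrightarrow> (f has_derivative f' x) (at x)" "\<And>v. Ck_map k S (\<lambda>x. f' x v)"
    by (metis Ck_map_SucE)
  have fk: "Ck_map k S f" using Suc.prems(1) by (rule Ck_map_SucD)
  have sk: "Ck_map k S (\<lambda>x. inverse (sqrt (f x)))"
    by (intro Ck_map_inverse Suc.IH fk assms(1)) (use Suc.prems(2) in force)+
  show ?case
  proof (rule Ck_map_SucI[where f' = "\<lambda>x v. inverse (sqrt (f x)) * (f' x v * (1/2))"])
    show "((\<lambda>x. sqrt (f x)) has_derivative (\<lambda>v. inverse (sqrt (f x)) * (f' x v * (1/2)))) (at x)"
      if "x \<in> S" for x
      using DERIV_compose_FDERIV[OF DERIV_real_sqrt[OF Suc.prems(2)[OF that]] f'(1)[OF that]]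
      by (simp add: mult_ac)
    show "Ck_map k S (\<lambda>x. inverse (sqrt (f x)) * (f' x v * (1/2)))" for v
      by (intro Ck_map_bilinear[OF bounded_bilinear_mult] assms(1) sk f' Ck_map_const)
  qed (rule assms(1))
qed

lemma Ck_map_exp:
  fixes f :: "'a::real_normed_vector \<Rightarrow> real"
  assumes "open S" "Ck_map k S f"
  shows "Ck_map k S (\<lambda>x. exp (f x))"
  using assms(2)
proof (induction k arbitrary: f)
  case 0
  then show ?case by (auto intro: continuous_on_exp)
next
  case (Suc k)
  from Suc.prems obtain f' where
    f': "\<And>x. x \<in> S \<Longrightarrow> (f has_derivative f' x) (at x)" "\<And>v. Ck_map k S (\<lambda>x. f' x v)"
    by (metis Ck_map_SucE)
  have fk: "Ck_map k S f" using Suc.prems(1) by (rule Ck_map_SucD)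
  show ?case
  proof (rule Ck_map_SucI[where f' = "\<lambda>x v. exp (f x) * f' x v"])
    show "((\<lambda>x. exp (f x)) has_derivative (\<lambda>v. exp (f x) * f' x v)) (at x)" if "x \<in> S" for x
      using DERIV_compose_FDERIV[OF DERIV_exp f'(1)[OF that]] by (simp add: mult.commute)
    show "Ck_map k S (\<lambda>x. exp (f x) * f' x v)" for v
      by (intro Ck_map_bilinear[OF bounded_bilinear_mult] assms(1) Suc.IH fk f')
  qed (rule assms(1))
qed

section \<open>Smoothness of inverses\<close>

text \<open>In finite dimensions an operator is a combination of its columns with constant
  rank-one operators, so regularity can be tested on each vector separately.\<close>

lemma Ck_map_blinfun:
  fixes M :: "'a::euclidean_space \<Rightarrow> 'b::euclidean_space \<Rightarrow>\<^sub>L 'c::euclidean_space"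
  assumes "open S" "\<And>v. Ck_map k S (\<lambda>x. M x v)"
  shows "Ck_map k S M"
proof -
  let ?E = "\<lambda>b y. blinfun_scaleR_left y o\<^sub>L blinfun_inner_left b"
  have "M x = (\<Sum>b\<in>Basis. ?E b (M x b))" for x
    by (rule blinfun_euclidean_eqI)
      (simp add: blinfun.bilinear_simps blinfun.sum_left inner_Basis if_distrib[of "\<lambda>c. c *\<^sub>R _"] cong: if_cong)
  moreover have "bounded_linear (?E b)" for b :: 'b
    by (intro bounded_linear_compose[OF bounded_bilinear.bounded_linear_left[OF bounded_bilinear_blinfun_compose]]
        bounded_linear_blinfun_scaleR_left)
  then have "Ck_map k S (\<lambda>x. \<Sum>b\<in>Basis. ?E b (M x b))"
    by (intro Ck_map_sum assms Ck_map_linear_image[where L = "?E _"])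
  ultimately show ?thesis by simp
qed

text \<open>Everything comes from the resolvent identity
  \<open>A y - A x = - A y (M y - M x) A x\<close>. It first bounds \<open>A\<close> near \<open>x\<close>, hence makes \<open>A\<close> continuous
  at \<open>x\<close>; with \<open>A y\<close> replaced by its limit and \<open>M y - M x\<close> by its linear part it gives the derivative.\<close>

lemma has_derivative_blinfun_inverse:
  fixes M :: "'a::real_normed_vector \<Rightarrow> 'b::real_normed_vector \<Rightarrow>\<^sub>L 'c::real_normed_vector"
  assumes "open S" "x \<in> S"
    and inv: "\<And>y. y \<in> S \<Longrightarrow> A y o\<^sub>L M y = id_blinfun" "\<And>y. y \<in> S \<Longrightarrow> M y o\<^sub>L A y = id_blinfun"
    and M': "(M has_derivative M') (at x)"
  shows "(A has_derivative (\<lambda>h. - (A x o\<^sub>L M' h o\<^sub>L A x))) (at x)"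
proof -
  have resolvent: "A y - A x = - (A y o\<^sub>L (M y - M x) o\<^sub>L A x)" if "y \<in> S" for y
  proof -
    have "A y o\<^sub>L (M y - M x) o\<^sub>L A x = ((A y o\<^sub>L M y) o\<^sub>L A x) - (A y o\<^sub>L (M x o\<^sub>L A x))"
      by (rule blinfun_eqI) (simp add: blinfun.bilinear_simps)
    also have "\<dots> = A x - A y"
      unfolding inv(1)[OF that] inv(2)[OF assms(2)] by (rule blinfun_eqI) (simp add: blinfun.bilinear_simps)
    finally show ?thesis by simp
  qed
  have evS: "eventually (\<lambda>y. y \<in> S) (at x)"
    using assms(1,2) eventually_at_topological by blast
  have Mx: "(M \<longlongrightarrow> M x) (at x)"
    using has_derivative_continuous[OF M'] by (simp add: continuous_within)
  define a where "a = norm (A x)"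
  have "((\<lambda>y. norm (M y - M x) * a) \<longlongrightarrow> 0) (at x)"
    using tendsto_mult_left_zero[OF tendsto_norm_zero[OF LIM_zero[OF Mx]]] .
  then have small: "eventually (\<lambda>y. norm (M y - M x) * a < 1/2) (at x)"
    by (rule order_tendstoD) simp
  have bound: "eventually (\<lambda>y. norm (A y) \<le> 2 * a) (at x)"
    using evS small
  proof eventually_elim
    case (elim y)
    have "norm (A y) \<le> norm (A x) + norm (A y - A x)"
      using norm_triangle_ineq[of "A x" "A y - A x"] by simp
    also have "norm (A y - A x) \<le> norm (A y) * norm (M y - M x) * norm (A x)"
      unfolding resolvent[OF elim(1)] norm_minus_cancel
      by (rule order_trans[OF norm_blinfun_compose mult_right_mono[OF norm_blinfun_compose norm_ge_zero]])
    also have "\<dots> \<le> norm (A y) * (1/2)"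
      using mult_left_mono[of "norm (M y - M x) * a" "1/2" "norm (A y)"] elim(2)
      by (simp add: a_def mult.assoc)
    finally show ?case by (simp add: a_def)
  qed
  have diff: "eventually (\<lambda>y. norm (A y - A x) \<le> 2 * a * (norm (M y - M x) * a)) (at x)"
    using evS bound
  proof eventually_elim
    case (elim y)
    have "norm (A y - A x) \<le> norm (A y) * norm (M y - M x) * norm (A x)"
      unfolding resolvent[OF elim(1)] norm_minus_cancel
      by (rule order_trans[OF norm_blinfun_compose mult_right_mono[OF norm_blinfun_compose norm_ge_zero]])
    also have "\<dots> \<le> 2 * a * norm (M y - M x) * norm (A x)"
      by (intro mult_right_mono elim(2)) auto
    finally show ?case by (simp add: a_def mult.assoc)
  qed
  have "((\<lambda>y. A y - A x) \<longlongrightarrow> 0) (at x)"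
  proof (rule tendsto_0_le[where K = "2 * a * a"])
    show "((\<lambda>y. M y - M x) \<longlongrightarrow> 0) (at x)" using LIM_zero[OF Mx] .
    show "eventually (\<lambda>y. norm (A y - A x) \<le> norm (M y - M x) * (2 * a * a)) (at x)"
      using diff by (simp add: mult.commute mult.left_commute)
  qed
  then have Ax: "(A \<longlongrightarrow> A x) (at x)" by (simp add: LIM_zero_iff)
  have blM': "bounded_linear M'" using M' by (rule has_derivative_bounded_linear)
  have blL: "bounded_linear (\<lambda>h. - (A x o\<^sub>L M' h o\<^sub>L A x))"
    by (intro bounded_linear_minus bounded_linear_compose[OF bounded_bilinear.bounded_linear_left[OF bounded_bilinear_blinfun_compose]]
       bounded_linear_compose[OF bounded_bilinear.bounded_linear_right[OF bounded_bilinear_blinfun_compose]] blM')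
  \<comment> \<open>The difference quotient of \<open>A\<close> splits into the remainder \<open>?R\<close> of the Taylor
    expansion of \<open>M\<close> and the bounded quotient \<open>?Q\<close> multiplied by \<open>A y - A x\<close>.\<close>
  let ?R = "\<lambda>y. inverse (norm (y - x)) *\<^sub>R (M y - M x - M' (y - x))"
  have R: "(?R \<longlongrightarrow> 0) (at x)"
    using M' by (simp add: has_derivative_at_within diff_diff_eq)
  obtain K where K: "\<And>h. norm (M' h) \<le> norm h * K" and "K \<ge> 0"
    using bounded_linear.nonneg_bounded[OF blM'] by blast
  let ?Q = "\<lambda>y. inverse (norm (y - x)) *\<^sub>R M' (y - x)"
  have Q: "((\<lambda>y. (A y - A x) o\<^sub>L ?Q y) \<longlongrightarrow> 0) (at x)"
  proof (rule tendsto_0_le[where K = K and f = "\<lambda>y. A y - A x"])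
    show "((\<lambda>y. A y - A x) \<longlongrightarrow> 0) (at x)" using Ax by (simp add: LIM_zero_iff)
    show "eventually (\<lambda>y. norm ((A y - A x) o\<^sub>L ?Q y) \<le> norm (A y - A x) * K) (at x)"
      using eventually_neq_at_within[of x x UNIV]
    proof eventually_elim
      case (elim y)
      have "norm (?Q y) \<le> K" using K[of "y - x"] elim by (simp add: divide_simps mult.commute)
      then show ?case
        by (rule order_trans[OF norm_blinfun_compose mult_left_mono[OF _ norm_ge_zero]])
    qed
  qed
  have "((\<lambda>y. - (((A y o\<^sub>L ?R y) + ((A y - A x) o\<^sub>L ?Q y)) o\<^sub>L A x)) \<longlongrightarrow> 0) (at x)"
  proof -
    have "((\<lambda>y. - (((A y o\<^sub>L ?R y) + ((A y - A x) o\<^sub>L ?Q y)) o\<^sub>L A x)) \<longlongrightarrow> - (((A x o\<^sub>L 0) + 0) o\<^sub>L A x)) (at x)"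
      by (intro tendsto_minus bounded_bilinear.tendsto[OF bounded_bilinear_blinfun_compose]
          tendsto_add Ax R Q tendsto_const)
    then show ?thesis by simp
  qed
  moreover have "eventually (\<lambda>y. - (((A y o\<^sub>L ?R y) + ((A y - A x) o\<^sub>L ?Q y)) o\<^sub>L A x)
      = inverse (norm (y - x)) *\<^sub>R (A y - A x - (- (A x o\<^sub>L M' (y - x) o\<^sub>L A x)))) (at x)"
    using evS
  proof eventually_elim
    case (elim y)
    have "- (((A y o\<^sub>L (c *\<^sub>R (D - T))) + ((A y - A x) o\<^sub>L (c *\<^sub>R T))) o\<^sub>L A x)
        = c *\<^sub>R (- (A y o\<^sub>L D o\<^sub>L A x) - (- (A x o\<^sub>L T o\<^sub>L A x)))" for c D T
      by (rule blinfun_eqI) (simp add: blinfun.bilinear_simps scaleR_diff_right scaleR_add_right)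
    from this[of "inverse (norm (y - x))" "M y - M x" "M' (y - x)"] show ?case
      by (simp only: resolvent[OF elim, symmetric])
  qed
  ultimately have "((\<lambda>y. inverse (norm (y - x)) *\<^sub>R (A y - A x - (- (A x o\<^sub>L M' (y - x) o\<^sub>L A x)))) \<longlongrightarrow> 0) (at x)"
    by (rule Lim_transform_eventually)
  then show ?thesis
    using blL unfolding has_derivative_at_within by (simp add: diff_diff_eq)
qed

text \<open>The derivative \<open>- A M' A\<close> of the inverse is a product of \<open>A\<close> itself and \<open>M'\<close>, so
  each order of regularity of \<open>A\<close> yields the next.\<close>

lemma Ck_map_blinfun_inverse:
  fixes M :: "'a::real_normed_vector \<Rightarrow> 'b::real_normed_vector \<Rightarrow>\<^sub>L 'c::real_normed_vector"
  assumes "open S"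
    and inv: "\<And>y. y \<in> S \<Longrightarrow> A y o\<^sub>L M y = id_blinfun" "\<And>y. y \<in> S \<Longrightarrow> M y o\<^sub>L A y = id_blinfun"
    and "Ck_map (Suc k) S M"
  shows "Ck_map (Suc k) S A"
  using assms(4)
proof (induction k)
  case 0
  then obtain M' where M': "\<And>x. x \<in> S \<Longrightarrow> (M has_derivative M' x) (at x)" "\<And>v. Ck_map 0 S (\<lambda>x. M' x v)"
    by (metis Ck_map_SucE)
  have "continuous_on S A"
    using has_derivative_blinfun_inverse[OF assms(1) _ inv M'(1)] has_derivative_continuous
    by (blast intro!: continuous_at_imp_continuous_on)
  then show ?case
    by (intro Ck_map_SucI[where f' = "\<lambda>x h. - (A x o\<^sub>L M' x h o\<^sub>L A x)"] assms(1)
        has_derivative_blinfun_inverse[OF assms(1) _ inv M'(1)]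
        Ck_map_linear_image[where L = uminus] Ck_map_bilinear[OF bounded_bilinear_blinfun_compose]
        M' bounded_linear_minus bounded_linear_ident) auto
next
  case (Suc k)
  then obtain M' where M': "\<And>x. x \<in> S \<Longrightarrow> (M has_derivative M' x) (at x)" "\<And>v. Ck_map (Suc k) S (\<lambda>x. M' x v)"
    by (metis Ck_map_SucE)
  have "Ck_map (Suc k) S A" using Suc Ck_map_SucD by blast
  then show ?case
    by (intro Ck_map_SucI[where f' = "\<lambda>x h. - (A x o\<^sub>L M' x h o\<^sub>L A x)" and k = "Suc k"] assms(1)
        has_derivative_blinfun_inverse[OF assms(1) _ inv M'(1)]
        Ck_map_linear_image[where L = uminus] Ck_map_bilinear[OF bounded_bilinear_blinfun_compose]
        M' bounded_linear_minus bounded_linear_ident)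
qed

text \<open>The inverse function theorem supplies a differentiable inverse \<open>g\<close> with
  \<open>Dg(y) = (Df(g y))\<inverse>\<close>. The right-hand side is a smooth function of \<open>g y\<close>, so regularity of \<open>g\<close>
  improves by one order at a time.\<close>

lemma smooth_local_inverse:
  fixes f :: "'a::euclidean_space \<Rightarrow> 'a"
  assumes "open U" "x0 \<in> U" and smooth: "\<And>k. Ck_map k U f"
    and der0: "(f has_derivative D) (at x0)" and "inj D"
  obtains U' V g where "open U'" "U' \<subseteq> U" "x0 \<in> U'" "open V" "f x0 \<in> V"
    "homeomorphism U' V f g" "\<And>k. Ck_map k V g"
proof -
  have dU: "f differentiable (at x)" if "x \<in> U" for x
    using smooth[of 1] that by simp
  define M where "M x = Blinfun (frechet_derivative f (at x))" for x
  have M: "blinfun_apply (M x) = frechet_derivative f (at x)" if "x \<in> U" for x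
    unfolding M_def using dU[OF that] frechet_derivative_works has_derivative_bounded_linear
    by (blast intro: bounded_linear_Blinfun_apply)
  have derM: "(f has_derivative blinfun_apply (M x)) (at x)" if "x \<in> U" for x
    using dU[OF that] M[OF that] frechet_derivative_works by auto
  have CkM: "Ck_map k U M" for k
  proof (rule Ck_map_blinfun[OF assms(1)])
    fix v
    have "Ck_map k U (\<lambda>x. frechet_derivative f (at x) v)"
      using smooth[of "Suc k"] by simp
    then show "Ck_map k U (\<lambda>x. blinfun_apply (M x) v)"
      by (subst Ck_map_cong[OF assms(1)]) (auto simp: M)
  qed
  have D: "D = blinfun_apply (M x0)"
    using der0 derM[OF assms(2)] has_derivative_unique by blast
  obtain N where N: "linear N" "N \<circ> D = id"
    using linear_injective_left_inverse[OF has_derivative_linear[OF der0] \<open>inj D\<close>] by blast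
  have "Blinfun N o\<^sub>L M x0 = id_blinfun"
    using N by (intro blinfun_eqI)
      (simp add: bounded_linear_Blinfun_apply linear_conv_bounded_linear D fun_eq_iff)
  then obtain U' V g g' where *: "open U'" "U' \<subseteq> U" "x0 \<in> U'" "open V" "f x0 \<in> V" "homeomorphism U' V f g"
    and g': "\<And>y. y \<in> V \<Longrightarrow> (g has_derivative (g' y)) (at y)"
    and g'eq: "\<And>y. y \<in> V \<Longrightarrow> g' y = inv (blinfun_apply (M (g y)))"
    and bij: "\<And>y. y \<in> V \<Longrightarrow> bij (blinfun_apply (M (g y)))"
    using inverse_function_theorem[OF assms(1) derM Ck_map_continuous[OF CkM] assms(2)] by metis
  have gV: "g ` V = U'" and fU': "f ` U' = V" and gf: "\<And>x. x \<in> U' \<Longrightarrow> g (f x) = x"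
    using *(6) by (auto simp: homeomorphism_def)
  define A where "A u = Blinfun (inv (blinfun_apply (M u)))" for u
  have A: "blinfun_apply (A u) = inv (blinfun_apply (M u))" and bijU: "bij (blinfun_apply (M u))" if "u \<in> U'" for u
  proof -
    have "f u \<in> V" "g (f u) = u" using that fU' gf by auto
    then show "bij (blinfun_apply (M u))" "blinfun_apply (A u) = inv (blinfun_apply (M u))"
      unfolding A_def using bij[of "f u"] g'[of "f u"] g'eq[of "f u"]
      by (auto intro!: bounded_linear_Blinfun_apply dest: has_derivative_bounded_linear)
  qed
  have AM: "A u o\<^sub>L M u = id_blinfun" "M u o\<^sub>L A u = id_blinfun" if "u \<in> U'" for u
    using A[OF that] bijU[OF that]
    by (auto intro!: blinfun_eqI simp: bij_is_inj bij_is_surj surj_f_inv_f)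
  have CkA: "Ck_map k U' A" for k
    using Ck_map_blinfun_inverse[OF *(1) AM Ck_map_subset[OF CkM *(2)], of k] Ck_map_SucD by blast
  have "Ck_map k V g" for k
  proof (induction k)
    case 0
    show ?case using *(6) by (simp add: homeomorphism_def)
  next
    case (Suc k)
    have "Ck_map k V (\<lambda>y. A (g y) v)" for v
      by (intro Ck_map_bilinear[OF bounded_bilinear_blinfun_apply] *(4) Ck_map_const
          Ck_map_compose[OF *(4,1) _ Suc CkA]) (simp add: gV)
    moreover have "(g has_derivative blinfun_apply (A (g y))) (at y)" if "y \<in> V" for y
      using g'[OF that] g'eq[OF that] A[of "g y"] gV that by auto
    ultimately show ?case by (intro Ck_map_SucI *(4))
  qed
  with * show ?thesis by (intro that)
qed

section \<open>Smoothness of the signed distance near a smooth boundary\<close>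

lemma abs_signed_dist: "\<bar>signed_dist \<Omega> x\<bar> = infdist x (frontier \<Omega>)"
  by (simp add: signed_dist_def infdist_nonneg)

text \<open>The ball is connected and misses the frontier, so it cannot meet both the set and
  its complement.\<close>

lemma ball_infdist_frontier:
  fixes x :: "'a::euclidean_space"
  assumes "r = infdist x (frontier \<Omega>)"
  shows "x \<in> \<Omega> \<Longrightarrow> ball x r \<subseteq> \<Omega>" "x \<notin> \<Omega> \<Longrightarrow> ball x r \<inter> \<Omega> = {}"
proof -
  have "ball x r \<inter> frontier \<Omega> = {}"
    using infdist_le[of _ "frontier \<Omega>" x] assms by fastforce
  then have *: "ball x r \<inter> \<Omega> = {} \<or> ball x r - \<Omega> = {}"
    using connected_Int_frontier[OF connected_ball] by blast
  show "ball x r \<subseteq> \<Omega>" if "x \<in> \<Omega>"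
    using * that by (metis Diff_eq_empty_iff Int_iff ball_eq_empty centre_in_ball empty_iff empty_subsetI linorder_not_le)
  show "ball x r \<inter> \<Omega> = {}" if "x \<notin> \<Omega>"
    using * that by (metis Diff_iff Int_empty_left ball_eq_empty centre_in_ball empty_iff linorder_not_le)
qed

text \<open>For points on different sides the segment between them crosses the frontier, and the
  crossing point bounds both distances at once.\<close>

lemma signed_dist_Lipschitz:
  fixes x y :: "'a::euclidean_space"
  shows "\<bar>signed_dist \<Omega> x - signed_dist \<Omega> y\<bar> \<le> dist x y"
proof -
  have mixed: "infdist x (frontier \<Omega>) + infdist y (frontier \<Omega>) \<le> dist x y"
    if "x \<in> \<Omega>" "y \<notin> \<Omega>" for x y
  proof -
    have "closed_segment x y \<inter> frontier \<Omega> \<noteq> {}"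
      by (rule connected_Int_frontier) (use that in auto)
    then obtain q where q: "q \<in> closed_segment x y" "q \<in> frontier \<Omega>" by blast
    have "infdist x (frontier \<Omega>) \<le> dist x q" "infdist y (frontier \<Omega>) \<le> dist y q"
      using q(2) by (auto intro: infdist_le)
    moreover have "dist x q + dist y q = dist x y"
      using q(1) between by (metis between_mem_segment dist_commute)
    ultimately show ?thesis by simp
  qed
  have same: "\<bar>infdist x (frontier \<Omega>) - infdist y (frontier \<Omega>)\<bar> \<le> dist x y"
    by (rule infdist_triangle_abs)
  have nn: "infdist z (frontier \<Omega>) \<ge> 0" for z by (rule infdist_nonneg)
  show ?thesis
    using mixed[of x y] mixed[of y x] same nn[of x] nn[of y]
    by (auto simp: signed_dist_def dist_commute)
qed

text \<open>A ball inside \<open>{f \<le> 0}\<close> that touches \<open>{f = 0}\<close> at \<open>y\<close> has its centre on the inner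
  normal line. Indeed every direction \<open>v\<close> pointing into the ball has \<open>n \<bullet> v \<le> 0\<close>; a half-space
  contained in another half-space has a parallel normal. This one argument gives both the Lagrange
  multiplier condition for a nearest point and the sign of the multiplier.\<close>

lemma touching_ball_normal:
  fixes n :: "'a::euclidean_space"
  assumes der: "(f has_derivative (\<lambda>v. n \<bullet> v)) (at y)" and "f y = 0" and "n \<noteq> 0"
    and "open U" "y \<in> U" and le: "\<And>u. u \<in> U \<Longrightarrow> u \<in> ball x (dist x y) \<Longrightarrow> f u \<le> (0::real)"
  obtains s where "s \<le> 0" "x - y = s *\<^sub>R n"
proof (cases "x = y")
  case True
  then show ?thesis using that[of 0] by simp
next
  case False
  define w where "w = x - y"
  have "w \<noteq> 0" using False by (simp add: w_def)
  have dir: "n \<bullet> v \<le> 0" if vw: "v \<bullet> w > 0" for v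
  proof (rule ccontr)
    assume "\<not> n \<bullet> v \<le> 0"
    then have pos: "n \<bullet> v > 0" by simp
    have "v \<noteq> 0" using vw by auto
    have "((\<lambda>t. f (y + t *\<^sub>R v)) has_derivative (\<lambda>t. n \<bullet> (t *\<^sub>R v))) (at 0)"
      by (rule has_derivative_compose[where g = f and f = "\<lambda>t. y + t *\<^sub>R v" and x = 0, of "\<lambda>t. t *\<^sub>R v"])
        (use der in \<open>auto intro!: derivative_eq_intros\<close>)
    then have "((\<lambda>t. f (y + t *\<^sub>R v)) has_real_derivative n \<bullet> v) (at 0)"
      by (rule has_derivative_imp_has_field_derivative) simp
    from DERIV_pos_inc_right[OF this pos] obtain d where d: "d > 0"
      "\<And>h. 0 < h \<Longrightarrow> h < d \<Longrightarrow> f y < f (y + h *\<^sub>R v)" by auto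
    obtain e where e: "e > 0" "ball y e \<subseteq> U"
      using \<open>open U\<close> \<open>y \<in> U\<close> openE by blast
    have vv: "v \<bullet> v > 0" "norm v > 0" using \<open>v \<noteq> 0\<close> by auto
    have "\<exists>h>0. h < a \<and> h < b \<and> h < c" if "a > 0" "b > 0" "c > 0" for a b c :: real
      using that by (intro exI[of _ "min a (min b c) / 2"]) auto
    then obtain h where h: "h > 0" "h < d" "h < v \<bullet> w / (v \<bullet> v)" "h < e / norm v"
      using d(1) e(1) vw vv by (metis divide_pos_pos)
    have "y + h *\<^sub>R v \<in> U"
      using h(1,4) vv e(2) by (auto simp: subset_iff dist_norm field_simps)
    moreover have "y + h *\<^sub>R v \<in> ball x (dist x y)"
    proof -
      have "(norm (w - h *\<^sub>R v))\<^sup>2 = (norm w)\<^sup>2 - h * (2 * (v \<bullet> w) - h * (v \<bullet> v))"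
        by (simp add: power2_norm_eq_inner inner_diff_left inner_diff_right algebra_simps inner_commute)
      moreover have "h * (v \<bullet> v) < v \<bullet> w" using h(3) vv by (simp add: field_simps)
      then have "h * (2 * (v \<bullet> w) - h * (v \<bullet> v)) > 0"
        using h(1) vw by (intro mult_pos_pos) auto
      ultimately have "(norm (w - h *\<^sub>R v))\<^sup>2 < (norm w)\<^sup>2" by simp
      then have "norm (w - h *\<^sub>R v) < norm w"
        by (rule power2_less_imp_less) simp
      then show ?thesis by (simp add: dist_norm w_def algebra_simps)
    qed
    ultimately show False
      using le d(2)[OF h(1,2)] \<open>f y = 0\<close> by fastforce
  qed
  have nw: "n \<bullet> w \<le> 0" using dir[of w] \<open>w \<noteq> 0\<close> by simp
  \<comment> \<open>\<open>D\<close> is the defect in the Cauchy-Schwarz inequality for \<open>n\<close> and \<open>w\<close>. If it were positive,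
    the part of \<open>n\<close> orthogonal to \<open>w\<close>, tilted slightly towards \<open>w\<close>, would be a direction into the
    ball along which \<open>f\<close> increases.\<close>
  define D where "D = (n \<bullet> n) * (w \<bullet> w) - (n \<bullet> w)\<^sup>2"
  have "D \<le> 0"
  proof (rule ccontr)
    assume "\<not> D \<le> 0"
    define e where "e = D / (2 * (1 - n \<bullet> w))"
    have e: "e > 0" "e * (n \<bullet> w) \<ge> - D / 2"
      using \<open>\<not> D \<le> 0\<close> nw by (auto simp: e_def field_simps)
    let ?v = "(w \<bullet> w) *\<^sub>R n - (n \<bullet> w) *\<^sub>R w + e *\<^sub>R w"
    have "?v \<bullet> w = e * (w \<bullet> w)"
      by (simp add: inner_add_left inner_diff_left algebra_simps)
    then have "n \<bullet> ?v \<le> 0" using e(1) \<open>w \<noteq> 0\<close> by (intro dir) simp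
    moreover have "n \<bullet> ?v = D + e * (n \<bullet> w)"
      by (simp add: D_def inner_add_right inner_diff_right algebra_simps power2_eq_square)
    ultimately show False using e(2) \<open>\<not> D \<le> 0\<close> by simp
  qed
  define s where "s = (n \<bullet> w) / (n \<bullet> n)"
  have nn: "n \<bullet> n > 0" using \<open>n \<noteq> 0\<close> by simp
  have "(w - s *\<^sub>R n) \<bullet> (w - s *\<^sub>R n) = D / (n \<bullet> n)"
    using nn by (simp add: s_def D_def inner_diff_left inner_diff_right inner_commute field_simps power2_eq_square)
  also have "\<dots> \<le> 0" using \<open>D \<le> 0\<close> nn by (simp add: divide_nonpos_pos)
  finally have "w = s *\<^sub>R n" by (metis eq_iff_diff_eq_0 inner_eq_zero_iff inner_ge_zero order_antisym)
  moreover have "s \<le> 0" using nw nn by (simp add: s_def divide_nonpos_pos)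
  ultimately show ?thesis using that by (simp add: w_def)
qed

text \<open>The normal coordinate \<open>s\<close> of \<open>x\<close> at a nearest boundary point carries the same sign
  as the signed distance: from inside, the touching ball lies in \<open>{\<rho> < 0}\<close>; from outside, the
  same argument applies to \<open>-\<rho>\<close>.\<close>

lemma nearest_boundary_point_normal:
  fixes \<Omega> :: "'a::euclidean_space set"
  assumes "open \<Omega>" "open U" and \<Omega>U: "\<Omega> \<inter> U = {z \<in> U. \<rho> z < 0}"
    and cont: "continuous_on U \<rho>" and y: "y \<in> U" "y \<in> frontier \<Omega>"
    and der: "(\<rho> has_derivative (\<lambda>v. n \<bullet> v)) (at y)" and "n \<noteq> 0"
    and near: "infdist x (frontier \<Omega>) = dist x y"
  obtains s where "x - y = s *\<^sub>R n" "signed_dist \<Omega> x = s * norm n" "\<rho> y = 0"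
proof -
  have "y \<notin> \<Omega>" "y \<in> closure \<Omega>"
    using y(2) \<open>open \<Omega>\<close> by (auto simp: frontier_def interior_open)
  have "\<rho> y = 0"
  proof (rule antisym)
    show "\<rho> y \<ge> 0" using \<Omega>U y(1) \<open>y \<notin> \<Omega>\<close> by force
    show "\<rho> y \<le> 0"
    proof (rule ccontr)
      assume "\<not> \<rho> y \<le> 0"
      have "open (U \<inter> \<rho> -` {0<..})"
        using cont \<open>open U\<close> by (simp add: continuous_open_preimage)
      moreover have "y \<in> U \<inter> \<rho> -` {0<..}" using y(1) \<open>\<not> \<rho> y \<le> 0\<close> by simp
      ultimately obtain z where "z \<in> \<Omega>" "z \<in> U" "\<rho> z > 0"
        using \<open>y \<in> closure \<Omega>\<close> closure_iff_nhds_not_empty[of y \<Omega>] by blast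
      then show False using \<Omega>U by force
    qed
  qed
  show thesis
  proof (cases "x \<in> \<Omega>")
    case True
    have "\<rho> u \<le> 0" if "u \<in> U" "u \<in> ball x (dist x y)" for u
    proof -
      have "u \<in> \<Omega> \<inter> U" using ball_infdist_frontier(1)[OF refl True] near that by auto
      then show ?thesis unfolding \<Omega>U by simp
    qed
    from touching_ball_normal[OF der \<open>\<rho> y = 0\<close> \<open>n \<noteq> 0\<close> \<open>open U\<close> y(1) this]
    obtain s where s: "s \<le> 0" "x - y = s *\<^sub>R n" by blast
    have "signed_dist \<Omega> x = s * norm n"
      using True near s by (simp add: signed_dist_def dist_norm)
    with s \<open>\<rho> y = 0\<close> show ?thesis using that by blast
  next
    case False
    have "- \<rho> u \<le> 0" if "u \<in> U" "u \<in> ball x (dist x y)" for u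
    proof -
      have "u \<notin> {z \<in> U. \<rho> z < 0}"
        using ball_infdist_frontier(2)[OF refl False] near that \<Omega>U by auto
      then show ?thesis using that(1) by simp
    qed
    moreover have "((\<lambda>z. - \<rho> z) has_derivative (\<lambda>v. (- n) \<bullet> v)) (at y)"
      using has_derivative_minus[OF der] by simp
    ultimately obtain s where s: "s \<le> 0" "x - y = s *\<^sub>R (- n)"
      using touching_ball_normal[of "\<lambda>z. - \<rho> z" "- n" y U x] \<open>\<rho> y = 0\<close> \<open>n \<noteq> 0\<close> \<open>open U\<close> y(1) by auto
    have "signed_dist \<Omega> x = (- s) * norm n"
      using False near s by (simp add: signed_dist_def dist_norm)
    with s \<open>\<rho> y = 0\<close> show ?thesis using that[of "- s"] by simp
  qed
qed

lemma Ck_map_gradient: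
  fixes \<rho> :: "'a::euclidean_space \<Rightarrow> real"
  assumes "open U" "\<And>k. Ck_map k U \<rho>"
  obtains n where "\<And>k. Ck_map k U n" "\<And>y. y \<in> U \<Longrightarrow> (\<rho> has_derivative (\<lambda>v. n y \<bullet> v)) (at y)"
proof
  define n where "n y = (\<Sum>b\<in>Basis. frechet_derivative \<rho> (at y) b *\<^sub>R b)" for y
  show "Ck_map k U n" for k
    unfolding n_def using assms(2)[of "Suc k"]
    by (intro Ck_map_sum assms(1) Ck_map_linear_image[where L = "\<lambda>c. c *\<^sub>R _"] bounded_linear_scaleR_left) auto
  show "(\<rho> has_derivative (\<lambda>v. n y \<bullet> v)) (at y)" if "y \<in> U" for y
  proof -
    have d: "\<rho> differentiable (at y)" using assms(2)[of 1] that by simp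
    have "frechet_derivative \<rho> (at y) v = n y \<bullet> v" for v
    proof -
      have "frechet_derivative \<rho> (at y) (\<Sum>b\<in>Basis. (v \<bullet> b) *\<^sub>R b)
          = (\<Sum>b\<in>Basis. (v \<bullet> b) * frechet_derivative \<rho> (at y) b)"
        using linear_frechet_derivative[OF d] by (simp add: linear_sum linear_cmul)
      then show ?thesis
        by (simp add: euclidean_representation n_def inner_sum_left inner_sum_right inner_commute[of _ v] mult.commute)
    qed
    then show ?thesis using d frechet_derivative_works by (metis (no_types, lifting) ext)
  qed
qed

lemma Ck_map_fst:
  fixes h :: "'a::euclidean_space \<Rightarrow> 'c::real_normed_vector"
  assumes "open U" "Ck_map k U h"
  shows "Ck_map k (U \<times> (UNIV :: 'b::real_normed_vector set)) (\<lambda>z. h (fst z))"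
  using assms by (intro Ck_map_compose[where T = U and f = h and g = fst])
    (auto intro!: open_Times Ck_map_bounded_linear bounded_linear_fst)

text \<open>Normal coordinates without a parametrisation of the boundary: with \<open>n\<close> the gradient of a local
  defining function \<open>\<rho>\<close>, the map \<open>F (y, s) = (y + s n(y), \<rho> y)\<close> is a local diffeomorphism at
  \<open>(p, 0)\<close>. For \<open>x\<close> near \<open>p\<close>, a nearest boundary point \<open>y\<close> and its normal coordinate \<open>s\<close> solve
  \<open>F (y, s) = (x, 0)\<close>, so by injectivity they are \<open>G (x, 0)\<close> for the smooth local inverse \<open>G\<close>,
  and the signed distance is \<open>s |n(y)|\<close>.\<close>

lemma signed_dist_smooth_near_boundary:
  fixes \<Omega> :: "'a::euclidean_space set"
  assumes "open \<Omega>" "smooth_boundary \<Omega>" "p \<in> frontier \<Omega>"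
  obtains N where "p \<in> N" "smooth_on N (signed_dist \<Omega>)"
proof -
  obtain U \<rho> where "p \<in> U" "smooth_on U \<rho>" "\<forall>z\<in>U. regular_at \<rho> z"
    and \<Omega>U: "\<Omega> \<inter> U = {z \<in> U. \<rho> z < 0}"
    using assms(2,3) unfolding smooth_boundary_def by blast
  then have U: "p \<in> U" "open U" and smooth\<rho>: "\<And>k. Ck_map k U \<rho>"
    and reg: "\<And>z. z \<in> U \<Longrightarrow> regular_at \<rho> z"
    by (simp_all add: smooth_on_def Ck_map_real)
  obtain n where Ckn: "\<And>k. Ck_map k U n"
    and dern: "\<And>y. y \<in> U \<Longrightarrow> (\<rho> has_derivative (\<lambda>v. n y \<bullet> v)) (at y)"
    using Ck_map_gradient[OF U(2) smooth\<rho>] by blast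
  have n0: "n y \<noteq> 0" if "y \<in> U" for y
    using reg[OF that] frechet_derivative_at[OF dern[OF that]] by (auto simp: regular_at_def)
  define F where "F z = (fst z + snd z *\<^sub>R n (fst z), \<rho> (fst z))" for z :: "'a \<times> real"
  have oU: "open (U \<times> (UNIV :: real set))" using U(2) by (simp add: open_Times)
  have CkF: "Ck_map k (U \<times> UNIV) F" for k
    unfolding F_def
    by (intro Ck_map_Pair Ck_map_add Ck_map_bilinear[OF bounded_bilinear_scaleR] oU
        Ck_map_bounded_linear[OF bounded_linear_fst] Ck_map_bounded_linear[OF bounded_linear_snd]
        Ck_map_fst[OF U(2) Ckn] Ck_map_fst[OF U(2) smooth\<rho>])
  obtain n' where n': "(n has_derivative n') (at p)"
    using Ckn[of 1] U(1) by (auto simp: differentiable_def)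
  define D where "D h = (fst h + snd h *\<^sub>R n p, n p \<bullet> fst h)" for h :: "'a \<times> real"
  have nfst: "((\<lambda>z. n (fst z)) has_derivative (\<lambda>h. n' (fst h))) (at (p, 0::real))"
    and \<rho>fst: "((\<lambda>z. \<rho> (fst z)) has_derivative (\<lambda>h. n p \<bullet> fst h)) (at (p, 0::real))"
    using has_derivative_compose[OF bounded_linear_imp_has_derivative[OF bounded_linear_fst], of _ _ "(p, 0)" UNIV]
      n' dern[OF U(1)] by auto
  have derF: "(F has_derivative D) (at (p, 0))"
    unfolding F_def D_def
    using has_derivative_Pair[OF has_derivative_add[OF bounded_linear_imp_has_derivative[OF bounded_linear_fst]
        has_derivative_scaleR[OF bounded_linear_imp_has_derivative[OF bounded_linear_snd] nfst]] \<rho>fst]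
    by simp
  have "inj D"
  proof (rule linear_injective_0[OF has_derivative_linear[OF derF], THEN iffD2], intro allI impI)
    fix h assume "D h = 0"
    then have 1: "fst h = - (snd h *\<^sub>R n p)" and 2: "n p \<bullet> fst h = 0"
      by (auto simp: D_def zero_prod_def eq_neg_iff_add_eq_0)
    then have "snd h = 0" using n0[OF U(1)] by simp
    then show "h = 0" using 1 by (simp add: prod_eq_iff)
  qed
  obtain U' V G where U': "open U'" "U' \<subseteq> U \<times> UNIV" "(p, 0) \<in> U'" and V: "open V" "F (p, 0) \<in> V"
    and hom: "homeomorphism U' V F G" and CkG: "\<And>k. Ck_map k V G"
    using smooth_local_inverse[OF oU _ CkF derF \<open>inj D\<close>] U(1) by blast
  have "\<rho> p = 0"
    using nearest_boundary_point_normal[OF assms(1) U(2) \<Omega>U Ck_map_continuous[OF smooth\<rho>] U(1) assms(3)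
        dern[OF U(1)] n0[OF U(1)], of p] assms(3) by (metis dist_self infdist_zero)
  then have pV: "(p, 0) \<in> V" using V(2) by (simp add: F_def)
  obtain A B where AB: "open A" "open B" "p \<in> A" "0 \<in> B" "A \<times> B \<subseteq> U'"
    using U'(1,3) by (metis mem_Sigma_iff open_prod_elim)
  define m where "m = norm (n p) / 2"
  have m: "m > 0" using n0[OF U(1)] by (simp add: m_def)
  have "open (U \<inter> (\<lambda>y. norm (n y)) -` {m<..})"
    by (intro continuous_open_preimage continuous_on_norm Ck_map_continuous[OF Ckn] U(2)) simp
  moreover have "p \<in> U \<inter> (\<lambda>y. norm (n y)) -` {m<..}"
    using U(1) n0[OF U(1)] by (simp add: m_def)
  ultimately obtain e1 where e1: "e1 > 0" "ball p e1 \<subseteq> (U \<inter> (\<lambda>y. norm (n y)) -` {m<..}) \<inter> A"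
    using AB(1,3) openE[of "(U \<inter> (\<lambda>y. norm (n y)) -` {m<..}) \<inter> A" p] by blast
  obtain e2 where e2: "e2 > 0" "ball 0 e2 \<subseteq> B" using AB openE by blast
  have "open ((\<lambda>x. (x, 0::real)) -` V)"
    by (rule open_vimage[OF V(1)]) (intro continuous_intros)
  moreover have "p \<in> (\<lambda>x. (x, 0::real)) -` V" using pV by simp
  ultimately obtain e3 where "e3 > 0" "ball p e3 \<subseteq> (\<lambda>x. (x, 0::real)) -` V"
    by (rule openE)
  then have e3: "e3 > 0" "\<And>x. x \<in> ball p e3 \<Longrightarrow> (x, 0) \<in> V" by auto
  \<comment> \<open>A nearest boundary point of \<open>x\<close> is within \<open>2\<epsilon>\<close> of \<open>p\<close>, and its normal coordinate is at
    most \<open>\<epsilon> / m\<close>; both must stay inside the domain \<open>A \<times> B\<close> on which \<open>F\<close> is injective.\<close>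
  define \<epsilon> where "\<epsilon> = min (e1 / 2) (min (m * e2) e3)"
  have \<epsilon>: "\<epsilon> > 0" "2 * \<epsilon> \<le> e1" "\<epsilon> \<le> m * e2" "\<epsilon> \<le> e3"
    using e1(1) e2(1) e3(1) m by (auto simp: \<epsilon>_def)
  define N where "N = ball p \<epsilon>"
  have NV: "(x, 0) \<in> V" if "x \<in> N" for x using that e3(2) \<epsilon>(4) by (simp add: N_def)
  have formula: "signed_dist \<Omega> x = snd (G (x, 0)) * norm (n (fst (G (x, 0))))" if "x \<in> N" for x
  proof -
    obtain y where y: "y \<in> frontier \<Omega>" "infdist x (frontier \<Omega>) = dist x y"
      using infdist_attains_inf[OF frontier_closed] assms(3) by blast
    have "dist x y \<le> dist x p" using infdist_le[OF assms(3), of x] y(2) by simp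
    then have xy: "dist x y < \<epsilon>" "dist p y < 2 * \<epsilon>"
      using that dist_triangle[of p y x] by (auto simp: N_def dist_commute)
    then have "y \<in> ball p e1" using \<epsilon>(2) by simp
    then have yU: "y \<in> U" "y \<in> A" and my: "m < norm (n y)" using e1(2) by auto
    obtain s where s: "x - y = s *\<^sub>R n y" "signed_dist \<Omega> x = s * norm (n y)" "\<rho> y = 0"
      using nearest_boundary_point_normal[OF assms(1) U(2) \<Omega>U Ck_map_continuous[OF smooth\<rho>] yU(1) y(1)
        dern[OF yU(1)] n0[OF yU(1)] y(2)] by blast
    have "\<bar>s\<bar> * m \<le> \<bar>s\<bar> * norm (n y)" using my by (intro mult_left_mono) auto
    also have "\<dots> = dist x y" using s(1) by (simp add: dist_norm)
    also have "\<dots> < m * e2" using xy(1) \<epsilon>(3) by simp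
    finally have "\<bar>s\<bar> < e2" using m by (simp add: mult.commute)
    then have "s \<in> B" using e2(2) by (auto simp: dist_norm)
    then have "(y, s) \<in> U'" using AB(5) yU(2) by blast
    moreover have "F (y, s) = (x, 0)" using s(1,3) by (simp add: F_def algebra_simps)
    ultimately have "G (x, 0) = (y, s)" using hom by (metis homeomorphism_apply1)
    then show ?thesis using s(2) by simp
  qed
  have oN: "open N" by (simp add: N_def)
  have GU: "fst (G (x, 0)) \<in> U" if "x \<in> N" for x
    using NV[OF that] hom U'(2) by (force simp: homeomorphism_def)
  have CkGN: "Ck_map k N (\<lambda>x. G (x, 0))" for k
    by (rule Ck_map_compose[OF oN V(1) _ _ CkG])
      (use NV in \<open>auto intro: Ck_map_Pair[OF oN Ck_map_bounded_linear[OF bounded_linear_ident oN] Ck_map_const]\<close>)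
  have CknG: "Ck_map k N (\<lambda>x. n (fst (G (x, 0))))" for k
    by (rule Ck_map_compose[OF oN U(2) _ _ Ckn])
      (use GU in \<open>auto intro: Ck_map_linear_image[OF bounded_linear_fst oN CkGN]\<close>)
  have "Ck_map k N (\<lambda>x. snd (G (x, 0)) * norm (n (fst (G (x, 0)))))" for k
    unfolding norm_eq_sqrt_inner
    by (intro Ck_map_bilinear[OF bounded_bilinear_mult] Ck_map_bilinear[OF bounded_bilinear_inner]
        Ck_map_sqrt Ck_map_linear_image[OF bounded_linear_snd] oN CkGN CknG)
      (use n0 GU in simp)
  then have "Ck_on k N (signed_dist \<Omega>)" for k
    unfolding Ck_map_real[symmetric] by (subst Ck_map_cong[OF oN formula])
  then show thesis
    using that[of N] oN \<epsilon>(1) by (simp add: smooth_on_def N_def)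
qed

section \<open>Second derivatives along real lines\<close>

text \<open>The first derivative is required only near \<open>0\<close>, since the restriction of a locally smooth
  function to a line is differentiable only near the base point. The second one is an iterated
  derivative, like those in the complex Hessian.\<close>

definition jet2 :: "(real \<Rightarrow> real) \<Rightarrow> real \<Rightarrow> real \<Rightarrow> bool" where
  "jet2 h a b \<longleftrightarrow> (\<exists>h'. (\<forall>\<^sub>F s in nhds 0. (h has_real_derivative h' s) (at s)) \<and>
     h' 0 = a \<and> (h' has_real_derivative b) (at 0))"

lemma jet2I:
  assumes "\<forall>\<^sub>F s in nhds 0. (h has_real_derivative h' s) (at s)" "h' 0 = a"
    "(h' has_real_derivative b) (at 0)"
  shows "jet2 h a b"
  using assms by (auto simp: jet2_def)

lemma jet2E:
  assumes "jet2 h a b"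
  obtains h' where "\<forall>\<^sub>F s in nhds 0. (h has_real_derivative h' s) (at s)" "h' 0 = a"
    "(h' has_real_derivative b) (at 0)"
  using assms by (auto simp: jet2_def)

lemma jet2_unique:
  assumes "jet2 h a b" "jet2 h a' b'"
  shows "a = a'" "b = b'"
proof -
  from assms(1) obtain h1 where 1: "\<forall>\<^sub>F s in nhds 0. (h has_real_derivative h1 s) (at s)" "h1 0 = a"
    "(h1 has_real_derivative b) (at 0)" by (rule jet2E)
  from assms(2) obtain h2 where 2: "\<forall>\<^sub>F s in nhds 0. (h has_real_derivative h2 s) (at s)" "h2 0 = a'"
    "(h2 has_real_derivative b') (at 0)" by (rule jet2E)
  have eq: "\<forall>\<^sub>F s in nhds 0. h1 s = h2 s"
    using 1(1) 2(1) by eventually_elim (rule DERIV_unique)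
  show "a = a'" using eventually_nhds_x_imp_x[OF eq] 1(2) 2(2) by simp
  show "b = b'" using 1(3) 2(3) DERIV_cong_ev[OF refl eq refl] DERIV_unique by blast
qed

lemma jet2_add:
  assumes "jet2 h a b" "jet2 k c d"
  shows "jet2 (\<lambda>s. h s + k s) (a + c) (b + d)"
proof -
  from assms(1) obtain h' where 1: "\<forall>\<^sub>F s in nhds 0. (h has_real_derivative h' s) (at s)" "h' 0 = a"
    "(h' has_real_derivative b) (at 0)" by (rule jet2E)
  from assms(2) obtain k' where 2: "\<forall>\<^sub>F s in nhds 0. (k has_real_derivative k' s) (at s)" "k' 0 = c"
    "(k' has_real_derivative d) (at 0)" by (rule jet2E)
  have "\<forall>\<^sub>F s in nhds 0. ((\<lambda>s. h s + k s) has_real_derivative h' s + k' s) (at s)"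
    using 1(1) 2(1) by eventually_elim (rule DERIV_add)
  then show ?thesis
    by (rule jet2I) (auto simp: 1 2 intro: DERIV_add)
qed

lemma jet2_mult:
  assumes "jet2 h a b" "jet2 k c d"
  shows "jet2 (\<lambda>s. h s * k s) (a * k 0 + h 0 * c) (b * k 0 + 2 * a * c + h 0 * d)"
proof -
  from assms(1) obtain h' where 1: "\<forall>\<^sub>F s in nhds 0. (h has_real_derivative h' s) (at s)" "h' 0 = a"
    "(h' has_real_derivative b) (at 0)" by (rule jet2E)
  from assms(2) obtain k' where 2: "\<forall>\<^sub>F s in nhds 0. (k has_real_derivative k' s) (at s)" "k' 0 = c"
    "(k' has_real_derivative d) (at 0)" by (rule jet2E)
  have hk: "(h has_real_derivative a) (at 0)" "(k has_real_derivative c) (at 0)"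
    using eventually_nhds_x_imp_x[OF 1(1)] eventually_nhds_x_imp_x[OF 2(1)] 1(2) 2(2) by simp_all
  have "\<forall>\<^sub>F s in nhds 0. ((\<lambda>s. h s * k s) has_real_derivative h' s * k s + h s * k' s) (at s)"
    using 1(1) 2(1) by eventually_elim (auto intro!: derivative_eq_intros)
  moreover have "((\<lambda>s. h' s * k s + h s * k' s) has_real_derivative b * k 0 + 2 * a * c + h 0 * d) (at 0)"
    using hk 1(2,3) 2(2,3) by (auto intro!: derivative_eq_intros)
  ultimately show ?thesis
    by (intro jet2I[where h' = "\<lambda>s. h' s * k s + h s * k' s"]) (auto simp: 1 2)
qed

lemma jet2_cmult: "jet2 h a b \<Longrightarrow> jet2 (\<lambda>s. c * h s) (c * a) (c * b)"
  using jet2_mult[of "\<lambda>s. c" 0 0 h a b, OF jet2I[where h' = "\<lambda>s. 0"]] by simp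

text \<open>The second derivative test for a minimum, with minimal value \<open>0\<close>. It is the only way in
  which a comparison of distances becomes an inequality between derivatives.\<close>

lemma jet2_local_min:
  assumes jet: "jet2 h a b" and "h 0 = 0" and nonneg: "\<forall>\<^sub>F s in nhds 0. h s \<ge> 0"
  shows "a = 0" "b \<ge> 0"
proof -
  from jet obtain h' where h': "\<forall>\<^sub>F s in nhds 0. (h has_real_derivative h' s) (at s)" "h' 0 = a"
    "(h' has_real_derivative b) (at 0)" by (rule jet2E)
  from eventually_conj[OF h'(1) nonneg] obtain d where d: "d > 0"
    "\<And>s. \<bar>s\<bar> < d \<Longrightarrow> (h has_real_derivative h' s) (at s) \<and> h s \<ge> 0"
    by (auto simp: eventually_nhds_metric dist_real_def)
  show "a = 0"
    by (rule DERIV_local_min[of h a 0 d]) (use d h'(2) \<open>h 0 = 0\<close> in auto)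
  show "b \<ge> 0"
  proof (rule ccontr)
    assume "\<not> b \<ge> 0"
    then obtain e where e: "e > 0" "\<And>s. 0 < s \<Longrightarrow> s < e \<Longrightarrow> h' s < 0"
      using DERIV_neg_dec_right[OF h'(3)] h'(2) \<open>a = 0\<close> by auto
    define s where "s = min d e / 2"
    have s: "0 < s" "s < d" "s < e" using d(1) e(1) by (auto simp: s_def)
    have "h 0 > h s"
    proof (rule DERIV_neg_imp_decreasing_open[OF s(1)])
      show "\<exists>y. (h has_real_derivative y) (at x) \<and> y < 0" if "0 < x" "x < s" for x
        using d(2)[of x] e(2)[of x] that s by (intro exI[of _ "h' x"]) auto
      show "continuous_on {0..s} h"
      proof (rule continuous_at_imp_continuous_on, rule ballI)
        fix x assume "x \<in> {0..s}"
        then show "isCont h x" using d(2)[of x] s by (auto intro: DERIV_isCont)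
      qed
    qed
    then show False using d(2)[of s] s \<open>h 0 = 0\<close> by simp
  qed
qed

definition dderiv2 :: "('a::real_normed_vector \<Rightarrow> real) \<Rightarrow> 'a \<Rightarrow> 'a \<Rightarrow> 'a \<Rightarrow> real" where
  "dderiv2 f p u v = frechet_derivative (\<lambda>x. frechet_derivative f (at x) v) (at p) u"

lemma C2_derivatives:
  assumes "Ck_map 2 U f" "x \<in> U"
  shows "(f has_derivative frechet_derivative f (at x)) (at x)"
    "((\<lambda>y. frechet_derivative f (at y) v) has_derivative (\<lambda>u. dderiv2 f x u v)) (at x)"
proof -
  have d: "f differentiable (at x)" "(\<lambda>y. frechet_derivative f (at y) v) differentiable (at x)"
    using assms by (simp_all add: numeral_2_eq_2)
  show "(f has_derivative frechet_derivative f (at x)) (at x)"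
    using d(1) frechet_derivative_works by blast
  show "((\<lambda>y. frechet_derivative f (at y) v) has_derivative (\<lambda>u. dderiv2 f x u v)) (at x)"
    using d(2) unfolding frechet_derivative_works dderiv2_def .
qed

lemma jet2_line:
  fixes f :: "'a::real_normed_vector \<Rightarrow> real"
  assumes "Ck_map 2 U f" "open U" "p \<in> U"
  shows "jet2 (\<lambda>s. f (p + s *\<^sub>R v)) (frechet_derivative f (at p) v) (dderiv2 f p v v)"
proof (rule jet2I[where h' = "\<lambda>s. frechet_derivative f (at (p + s *\<^sub>R v)) v"])
  have chain: "((\<lambda>s. g (p + s *\<^sub>R v)) has_real_derivative g' v) (at s)"
    if g: "(g has_derivative g') (at (p + s *\<^sub>R v))" for g g' and s :: real
  proof (rule has_derivative_imp_has_field_derivative)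
    show "((\<lambda>s. g (p + s *\<^sub>R v)) has_derivative (\<lambda>t. g' (t *\<^sub>R v))) (at s)"
    proof -
      have "((\<lambda>s. p + s *\<^sub>R v) has_derivative (\<lambda>t. t *\<^sub>R v)) (at s)"
        using has_derivative_add[OF has_derivative_const[of p]
            bounded_linear_imp_has_derivative[OF bounded_linear_scaleR_left[of v]]] by simp
      from has_derivative_compose[OF this, of g g'] g show ?thesis by simp
    qed
    show "h * g' v = g' (h *\<^sub>R v)" for h
      using linear_cmul[OF has_derivative_linear[OF g], of h v] by simp
  qed
  have "((\<lambda>s. p + s *\<^sub>R v) \<longlongrightarrow> p) (nhds 0)"
    using tendsto_add[OF tendsto_const[of p] tendsto_scaleR[OF filterlim_ident[of "nhds (0::real)"] tendsto_const[of v]]]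
    by simp
  then have "\<forall>\<^sub>F s in nhds 0. p + s *\<^sub>R v \<in> U"
    using assms(2,3) by (rule topological_tendstoD)
  then show "\<forall>\<^sub>F s in nhds 0. ((\<lambda>s. f (p + s *\<^sub>R v)) has_real_derivative
      frechet_derivative f (at (p + s *\<^sub>R v)) v) (at s)"
    by eventually_elim (rule chain C2_derivatives(1) assms(1))+
  show "((\<lambda>s. frechet_derivative f (at (p + s *\<^sub>R v)) v) has_real_derivative dderiv2 f p v v) (at 0)"
    by (rule chain[of "\<lambda>y. frechet_derivative f (at y) v" "\<lambda>u. dderiv2 f p u v"])
      (use C2_derivatives(2)[OF assms(1,3)] in simp)
qed simp

lemma jet2_exp_norm_sq:
  fixes p v :: "'a::real_inner"
  shows "jet2 (\<lambda>s. exp (- t * (norm (p + s *\<^sub>R v))\<^sup>2)) (- 2 * t * (p \<bullet> v) * exp (- t * (norm p)\<^sup>2))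
    ((4 * t\<^sup>2 * (p \<bullet> v)\<^sup>2 - 2 * t * (v \<bullet> v)) * exp (- t * (norm p)\<^sup>2))"
proof -
  have sq: "(norm (p + s *\<^sub>R v))\<^sup>2 = p \<bullet> p + 2 * s * (p \<bullet> v) + s\<^sup>2 * (v \<bullet> v)" for s
    unfolding power2_norm_eq_inner
    by (simp add: inner_add_left inner_add_right inner_commute[of v p] algebra_simps power2_eq_square)
  show ?thesis
    unfolding sq unfolding power2_norm_eq_inner
  proof (rule jet2I[where h' = "\<lambda>s. - t * (2 * (p \<bullet> v) + 2 * s * (v \<bullet> v)) * exp (- t * (p \<bullet> p + 2 * s * (p \<bullet> v) + s\<^sup>2 * (v \<bullet> v)))"],
      goal_cases)
    case 1
    show ?case by (intro always_eventually allI) (auto intro!: derivative_eq_intros)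
  next
    case 3
    show ?case by (auto intro!: derivative_eq_intros simp: algebra_simps power2_eq_square)
  qed simp
qed

text \<open>A real line in the plane that starts at \<open>1\<close> with velocity \<open>A\<close>: the modulus grows at
  rate \<open>Re A\<close>, and its convexity comes from the component of \<open>A\<close> tangential to the unit circle.\<close>

lemma jet2_cmod:
  "jet2 (\<lambda>s. cmod (1 + of_real s * A)) (Re A) ((Im A)\<^sup>2)"
proof -
  let ?P = "\<lambda>s. 1 + 2 * s * Re A + s\<^sup>2 * (cmod A)\<^sup>2"
  have cm: "cmod (1 + of_real s * A) = sqrt (?P s)" for s
    by (simp add: cmod_def algebra_simps power2_eq_square)
  have "(?P \<longlongrightarrow> ?P 0) (nhds 0)"
    by (rule tendsto_eq_intros filterlim_ident refl)+
  then have "\<forall>\<^sub>F s in nhds 0. ?P s > 0"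
    by (rule order_tendstoD) simp
  then have "\<forall>\<^sub>F s in nhds 0. ((\<lambda>s. sqrt (?P s)) has_real_derivative
      (Re A + s * (cmod A)\<^sup>2) / sqrt (?P s)) (at s)"
    by eventually_elim (auto intro!: derivative_eq_intros simp: field_simps)
  moreover have "((\<lambda>s. (Re A + s * (cmod A)\<^sup>2) / sqrt (?P s)) has_real_derivative (Im A)\<^sup>2) (at 0)"
    by (auto intro!: derivative_eq_intros simp: algebra_simps simp flip: power2_eq_square) (simp add: cmod_power2)
  ultimately show ?thesis
    unfolding cm by (intro jet2I[where h' = "\<lambda>s. (Re A + s * (cmod A)\<^sup>2) / sqrt (?P s)"]) auto
qed

section \<open>The complex Hessian in real terms\<close>

lemma linear_complex_expand:
  fixes L :: "complex ^ 'n::finite \<Rightarrow> 'b::real_vector"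
  assumes "linear L"
  shows "L X = (\<Sum>i\<in>UNIV. Re (X $ i) *\<^sub>R L (axis i 1) + Im (X $ i) *\<^sub>R L (axis i \<i>))"
proof -
  have "X = (\<Sum>i\<in>UNIV. Re (X $ i) *\<^sub>R axis i 1 + Im (X $ i) *\<^sub>R axis i \<i>)"
    by (simp add: vec_eq_iff axis_def sum.distrib complex_eq_iff if_distrib cong: if_cong)
  then have "L X = L (\<Sum>i\<in>UNIV. Re (X $ i) *\<^sub>R axis i 1 + Im (X $ i) *\<^sub>R axis i \<i>)"
    by (rule arg_cong)
  also have "\<dots> = (\<Sum>i\<in>UNIV. Re (X $ i) *\<^sub>R L (axis i 1) + Im (X $ i) *\<^sub>R L (axis i \<i>))"
    by (simp add: linear_sum[OF assms] linear_add[OF assms] linear_cmul[OF assms])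
  finally show ?thesis .
qed

lemma frechet_derivative_of_real:
  assumes "f differentiable (at p)"
  shows "frechet_derivative (\<lambda>z. complex_of_real (f z)) (at p) v = of_real (frechet_derivative f (at p) v)"
proof -
  have "((\<lambda>z. complex_of_real (f z)) has_derivative (\<lambda>v. of_real (frechet_derivative f (at p) v))) (at p)"
    using has_derivative_of_real assms frechet_derivative_works by blast
  then show ?thesis by (metis frechet_derivative_at)
qed

text \<open>By real linearity the Wirtinger derivatives recombine to the complex linear part of \<open>Df\<close>.
  Hence a vector of type (1,0) annihilates a real function exactly when both real directions \<open>X\<close>
  and \<open>\<i>X\<close> do.\<close>

lemma apply_10_eq:
  fixes f :: "complex ^ 'n::finite \<Rightarrow> real"
  assumes "f differentiable (at p)"
  shows "apply_10 X f p = Complex (frechet_derivative f (at p) X / 2) (- frechet_derivative f (at p) (\<i> *s X) / 2)"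
proof -
  let ?D = "frechet_derivative f (at p)"
  have L: "linear ?D" using assms by (rule linear_frechet_derivative)
  have "Re (apply_10 X f p) = ?D X / 2"
    unfolding linear_complex_expand[OF L, of X]
    by (simp add: apply_10_def d_z_def frechet_derivative_of_real[OF assms] sum_divide_distrib[symmetric] add_divide_distrib)
  moreover have "Im (apply_10 X f p) = (\<Sum>i\<in>UNIV. (Im (X $ i) * ?D (axis i 1) - Re (X $ i) * ?D (axis i \<i>)) / 2)"
    by (simp add: apply_10_def d_z_def frechet_derivative_of_real[OF assms] diff_divide_distrib)
  then have "Im (apply_10 X f p) = - ?D (\<i> *s X) / 2"
    unfolding linear_complex_expand[OF L, of "\<i> *s X"]
    by (simp add: sum_divide_distrib[symmetric] sum_negf[symmetric])
  ultimately show ?thesis by (simp add: complex_eq_iff)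
qed

lemma apply_10_eq_0_iff:
  fixes f :: "complex ^ 'n::finite \<Rightarrow> real"
  assumes "f differentiable (at p)"
  shows "apply_10 X f p = 0 \<longleftrightarrow> frechet_derivative f (at p) X = 0 \<and> frechet_derivative f (at p) (\<i> *s X) = 0"
  unfolding apply_10_eq[OF assms] by (simp add: complex_eq_iff)

lemma dderiv2_linear:
  assumes "Ck_map 2 U f" "open U" "p \<in> U"
  shows "linear (\<lambda>u. dderiv2 f p u v)" "linear (dderiv2 f p u)"
proof -
  note d1 = C2_derivatives(1)[OF assms(1)] and d2 = C2_derivatives(2)[OF assms(1,3)]
  show "linear (\<lambda>u. dderiv2 f p u v)" using has_derivative_linear[OF d2] .
  have lin: "linear (frechet_derivative f (at x))" if "x \<in> U" for x
    using has_derivative_linear[OF d1[OF that]] .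
  show "linear (dderiv2 f p u)"
  proof (rule linearI)
    fix v w
    have "((\<lambda>x. frechet_derivative f (at x) (v + w)) has_derivative (\<lambda>u. dderiv2 f p u v + dderiv2 f p u w)) (at p)"
      by (rule has_derivative_transform_within_open[OF has_derivative_add[OF d2 d2] assms(2,3)])
        (simp add: linear_add[OF lin])
    from has_derivative_unique[OF this d2] show "dderiv2 f p u (v + w) = dderiv2 f p u v + dderiv2 f p u w"
      by metis
  next
    fix c v
    have "((\<lambda>x. frechet_derivative f (at x) (c *\<^sub>R v)) has_derivative (\<lambda>u. c *\<^sub>R dderiv2 f p u v)) (at p)"
      by (rule has_derivative_transform_within_open[OF has_derivative_scaleR_right[OF d2] assms(2,3)])
        (simp add: linear_cmul[OF lin])
    from has_derivative_unique[OF this d2] show "dderiv2 f p u (c *\<^sub>R v) = c *\<^sub>R dderiv2 f p u v"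
      by metis
  qed
qed

text \<open>The complex Hessian is a quarter of the Laplacian of the restriction to the complex line
  through \<open>p\<close> in the direction \<open>X\<close>. Both sides are expanded in the coordinate directions
  and agree entry by entry.\<close>

lemma Re_complex_Hess:
  fixes f :: "complex ^ 'n::finite \<Rightarrow> real"
  assumes C2: "Ck_map 2 U f" "open U" "p \<in> U"
  shows "Re (complex_Hess f p X) = (dderiv2 f p X X + dderiv2 f p (\<i> *s X) (\<i> *s X)) / 4"
proof -
  let ?H = "dderiv2 f p"
  note d1 = C2_derivatives(1)[OF C2(1)] and d2 = C2_derivatives(2)[OF C2(1,3)]
  have zbar: "(d_zbar j (\<lambda>z. of_real (f z)) has_derivative
      (\<lambda>u. (of_real (?H u (axis j 1)) + \<i> * of_real (?H u (axis j \<i>))) / 2)) (at p)" for j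
  proof (rule has_derivative_transform_within_open[OF _ C2(2,3)])
    show "((\<lambda>x. (complex_of_real (frechet_derivative f (at x) (axis j 1)) +
          \<i> * complex_of_real (frechet_derivative f (at x) (axis j \<i>))) / 2) has_derivative
      (\<lambda>u. (of_real (?H u (axis j 1)) + \<i> * of_real (?H u (axis j \<i>))) / 2)) (at p)"
      by (intro bounded_linear.has_derivative[OF bounded_linear_divide] has_derivative_add
          has_derivative_of_real has_derivative_mult_right d2)
    show "(complex_of_real (frechet_derivative f (at x) (axis j 1)) +
          \<i> * complex_of_real (frechet_derivative f (at x) (axis j \<i>))) / 2 = d_zbar j (\<lambda>z. of_real (f z)) x"
      if "x \<in> U" for x
    proof -
      have "f differentiable (at x)" using d1[OF that] by (auto simp: differentiable_def)
      then show ?thesis by (simp add: d_zbar_def frechet_derivative_of_real)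
    qed
  qed
  have entry: "d_z i (d_zbar j (\<lambda>z. of_real (f z))) p =
      Complex ((?H (axis i 1) (axis j 1) + ?H (axis i \<i>) (axis j \<i>)) / 4)
        ((?H (axis i 1) (axis j \<i>) - ?H (axis i \<i>) (axis j 1)) / 4)" for i j
    unfolding d_z_def frechet_derivative_at[OF zbar, symmetric]
    by (simp add: complex_eq_iff field_simps)
  have expand: "?H Y Y = (\<Sum>i\<in>UNIV. \<Sum>j\<in>UNIV.
      Re (Y $ i) * (Re (Y $ j) * ?H (axis i 1) (axis j 1) + Im (Y $ j) * ?H (axis i 1) (axis j \<i>))
      + Im (Y $ i) * (Re (Y $ j) * ?H (axis i \<i>) (axis j 1) + Im (Y $ j) * ?H (axis i \<i>) (axis j \<i>)))" for Y
    using linear_complex_expand[OF dderiv2_linear(1)[OF C2], of Y Y]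
    by (simp add: linear_complex_expand[OF dderiv2_linear(2)[OF C2], of _ Y] sum_distrib_left sum.distrib distrib_left)
  show ?thesis
    unfolding complex_Hess_def expand entry sum.distrib[symmetric] sum_divide_distrib Re_sum
    by (intro sum.cong refl) (simp add: field_simps)
qed

section \<open>Plurisubharmonicity of minus the logarithm of the boundary distance\<close>

lemma norm_vector_smult: "norm (c *s v) = cmod c * norm (v :: complex ^ 'n::finite)"
  by (simp add: norm_vec_def norm_mult L2_set_right_distrib)

lemma of_real_vector_smult: "complex_of_real s *s v = s *\<^sub>R (v :: complex ^ 'n::finite)"
  by (simp add: vec_eq_iff) (simp add: scaleR_conv_of_real)

text \<open>The complex line through \<open>z\<close> in the direction \<open>w\<close> is compared with a line through the
  nearest boundary point \<open>z0\<close>. The direction of the latter is chosen so that corresponding points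
  differ by \<open>(1 + \<tau> A)(z0 - z)\<close>, a holomorphic rotation and dilation of the connecting normal
  segment; the parameter \<open>A\<close> remains free.\<close>

lemma signed_dist_complex_line_comparison:
  fixes w :: "complex ^ 'n::finite"
  assumes "signed_dist \<Omega> z = - dist z z0"
  shows "0 \<le> signed_dist \<Omega> (z + \<tau> *s w) + dist z z0 * cmod (1 + \<tau> * A)
      + (-1) * signed_dist \<Omega> (z0 + \<tau> *s (w + A *s (z0 - z)))"
proof -
  have "z0 + \<tau> *s (w + A *s (z0 - z)) - (z + \<tau> *s w) = (1 + \<tau> * A) *s (z0 - z)"
    by (simp add: vec_eq_iff algebra_simps)
  then have "dist (z0 + \<tau> *s (w + A *s (z0 - z))) (z + \<tau> *s w) = cmod (1 + \<tau> * A) * dist z z0"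
    by (simp only: dist_norm norm_vector_smult norm_minus_commute[of z0 z])
  then show ?thesis
    using signed_dist_Lipschitz[of \<Omega> "z0 + \<tau> *s (w + A *s (z0 - z))" "z + \<tau> *s w"]
    by (simp add: mult.commute)
qed

text \<open>Oka's lemma in differential form: \<open>-log(-\<delta>)\<close> is plurisubharmonic at \<open>z\<close> if the Levi
  form is nonnegative at the nearest boundary point. The difference \<open>q\<close> of the two sides of the
  comparison above is nonnegative and vanishes at \<open>\<tau> = 0\<close>, so its gradient vanishes there and its
  Laplacian is nonnegative. Choosing \<open>A\<close> so that the modulus term absorbs the first derivative of
  \<open>\<delta>\<close> at \<open>z\<close> makes the comparison direction \<open>w'\<close> at \<open>z0\<close> a complex tangent vector. Pseudoconvexity
  then discards the Hessian at \<open>z0\<close>, and the Laplacian \<open>d |A|\<^sup>2\<close> of the modulus term is the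
  claimed error.\<close>

lemma oka_inequality:
  fixes \<Omega> :: "(complex ^ 'n::finite) set"
  defines "\<delta> \<equiv> signed_dist \<Omega>"
  assumes "pseudoconvex \<Omega>"
    and z0: "z0 \<in> frontier \<Omega>" "\<delta> z = - dist z z0" "z \<noteq> z0"
    and U: "Ck_map 2 U \<delta>" "open U" "z \<in> U" and N: "Ck_map 2 N \<delta>" "open N" "z0 \<in> N"
  shows "dderiv2 \<delta> z w w + dderiv2 \<delta> z (\<i> *s w) (\<i> *s w)
    \<ge> ((frechet_derivative \<delta> (at z) w)\<^sup>2 + (frechet_derivative \<delta> (at z) (\<i> *s w))\<^sup>2) / \<delta> z"
proof -
  let ?D = "frechet_derivative \<delta> (at z)" and ?Db = "frechet_derivative \<delta> (at z0)"
  define d where "d = dist z z0"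
  have d: "d > 0" using z0(3) by (simp add: d_def)
  define A where "A = Complex (- ?D w / d) (?D (\<i> *s w) / d)"
  define w' where "w' = w + A *s (z0 - z)"
  have \<delta>0: "\<delta> z0 = 0" using z0(1) abs_signed_dist[of \<Omega> z0] by (simp add: \<delta>_def)
  define q where "q v B v' s = \<delta> (z + s *\<^sub>R v) + d * cmod (1 + of_real s * B) + (-1) * \<delta> (z0 + s *\<^sub>R v')"
    for v v' B s
  have jet: "jet2 (q v B v') (?D v + d * Re B + (-1) * ?Db v')
      (dderiv2 \<delta> z v v + d * (Im B)\<^sup>2 + (-1) * dderiv2 \<delta> z0 v' v')" for v B v'
    unfolding q_def by (intro jet2_add jet2_cmult jet2_line[OF U] jet2_line[OF N] jet2_cmod)
  have q0: "q v B v' 0 = 0" for v B v' using z0(2) \<delta>0 by (simp add: q_def d_def)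
  have second_order: "?D v + d * Re B + (-1) * ?Db v' = 0"
      "dderiv2 \<delta> z v v + d * (Im B)\<^sup>2 + (-1) * dderiv2 \<delta> z0 v' v' \<ge> 0"
    if "\<And>s. 0 \<le> q v B v' s" for v B v'
    by (rule jet2_local_min[OF jet q0 always_eventually]; simp add: that)+
  have "0 \<le> q w A w' s" for s
    using signed_dist_complex_line_comparison[of \<Omega> z z0 "of_real s" w A, folded \<delta>_def w'_def d_def] z0(2)
    by (simp add: q_def d_def of_real_vector_smult)
  then have 1: "?D w + d * Re A + (-1) * ?Db w' = 0"
      "dderiv2 \<delta> z w w + d * (Im A)\<^sup>2 + (-1) * dderiv2 \<delta> z0 w' w' \<ge> 0"
    by (rule second_order)+
  \<comment> \<open>The same comparison along the imaginary axis \<open>\<tau> = \<i> s\<close>.\<close>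
  have "0 \<le> q (\<i> *s w) (\<i> * A) (\<i> *s w') s" for s
    using signed_dist_complex_line_comparison[of \<Omega> z z0 "of_real s * \<i>" w A, folded \<delta>_def w'_def d_def] z0(2)
    by (simp add: q_def d_def of_real_vector_smult[symmetric] vector_smult_assoc mult.assoc)
  then have 2: "?D (\<i> *s w) + d * Re (\<i> * A) + (-1) * ?Db (\<i> *s w') = 0"
      "dderiv2 \<delta> z (\<i> *s w) (\<i> *s w) + d * (Im (\<i> * A))\<^sup>2 + (-1) * dderiv2 \<delta> z0 (\<i> *s w') (\<i> *s w') \<ge> 0"
    by (rule second_order)+
  have "?Db w' = 0" "?Db (\<i> *s w') = 0"
    using 1(1) 2(1) d by (simp_all add: A_def)
  moreover have "\<delta> differentiable (at z0)"
    using C2_derivatives(1)[OF N(1,3)] by (auto simp: differentiable_def)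
  ultimately have "apply_10 w' \<delta> z0 = 0" by (simp add: apply_10_eq_0_iff)
  then have "Re (complex_Hess \<delta> z0 w') \<ge> 0"
    using assms(2) z0(1) by (simp add: pseudoconvex_def \<delta>_def)
  then have "dderiv2 \<delta> z0 w' w' + dderiv2 \<delta> z0 (\<i> *s w') (\<i> *s w') \<ge> 0"
    by (simp add: Re_complex_Hess[OF N])
  then have "dderiv2 \<delta> z w w + dderiv2 \<delta> z (\<i> *s w) (\<i> *s w) \<ge> - (d * ((Im A)\<^sup>2 + (Re A)\<^sup>2))"
    using 1(2) 2(2) by (simp add: algebra_simps)
  also have "d * ((Im A)\<^sup>2 + (Re A)\<^sup>2) = ((?D w)\<^sup>2 + (?D (\<i> *s w))\<^sup>2) / d"
    using d by (simp add: A_def field_simps power2_eq_square)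
  finally show ?thesis using z0(2) by (simp add: d_def)
qed

section \<open>Level sets of the weighted distance\<close>

text \<open>Only the diagonal values \<open>D\<^sub>v D\<^sub>v\<close> enter the complex Hessian, so the product rule for
  functions of one real variable suffices: both sides are the 2-jet of the same restriction to a line.\<close>

lemma weighted_distance_derivatives:
  fixes \<delta> :: "'a::euclidean_space \<Rightarrow> real"
  defines "E \<equiv> \<lambda>t z. exp (- t * (norm z)\<^sup>2)"
  assumes smooth: "smooth_on U \<delta>" "z \<in> U"
  shows "smooth_on U (\<lambda>z. \<delta> z * E t z)"
    and "frechet_derivative (\<lambda>z. \<delta> z * E t z) (at z) v
      = E t z * (frechet_derivative \<delta> (at z) v - 2 * t * \<delta> z * (z \<bullet> v))"
    and "dderiv2 (\<lambda>z. \<delta> z * E t z) z v v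
      = E t z * (dderiv2 \<delta> z v v - 4 * t * (z \<bullet> v) * frechet_derivative \<delta> (at z) v
          + \<delta> z * (4 * t\<^sup>2 * (z \<bullet> v)\<^sup>2 - 2 * t * (v \<bullet> v)))"
proof -
  have oU: "open U" and Ck: "\<And>k. Ck_map k U \<delta>" using smooth(1) by (auto simp: smooth_on_def Ck_map_real)
  have Ckr: "Ck_map k U (\<lambda>z. \<delta> z * E t z)" for k
    unfolding E_def power2_norm_eq_inner
    by (intro Ck_map_bilinear[OF bounded_bilinear_mult] Ck_map_bilinear[OF bounded_bilinear_inner]
        Ck_map_exp oU Ck Ck_map_const Ck_map_bounded_linear[OF bounded_linear_ident])
  then show "smooth_on U (\<lambda>z. \<delta> z * E t z)" using oU by (simp add: smooth_on_def Ck_map_real)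
  note j = jet2_unique[OF jet2_line[OF Ckr oU smooth(2), of v, unfolded E_def]
      jet2_mult[OF jet2_line[OF Ck oU smooth(2), of v] jet2_exp_norm_sq[of t z v]]]
  show "frechet_derivative (\<lambda>z. \<delta> z * E t z) (at z) v
      = E t z * (frechet_derivative \<delta> (at z) v - 2 * t * \<delta> z * (z \<bullet> v))"
    using j(1) by (simp add: E_def algebra_simps)
  show "dderiv2 (\<lambda>z. \<delta> z * E t z) z v v
      = E t z * (dderiv2 \<delta> z v v - 4 * t * (z \<bullet> v) * frechet_derivative \<delta> (at z) v
          + \<delta> z * (4 * t\<^sup>2 * (z \<bullet> v)\<^sup>2 - 2 * t * (v \<bullet> v)))"
    using j(2) by (simp add: E_def algebra_simps)
qed

text \<open>The gradient of the distance is nonzero in a quantitative way: along the segment to the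
  nearest boundary point the signed distance increases at unit speed. One inequality is the Lipschitz
  bound from \<open>z0\<close>; equality at \<open>s = 0\<close> makes it a statement about derivatives.\<close>

lemma signed_dist_derivative_to_nearest:
  fixes \<Omega> :: "'a::euclidean_space set"
  assumes U: "Ck_map 2 U (signed_dist \<Omega>)" "open U" "z \<in> U"
    and z0: "z0 \<in> frontier \<Omega>" "signed_dist \<Omega> z = - dist z z0"
  shows "frechet_derivative (signed_dist \<Omega>) (at z) (z0 - z) = dist z z0"
proof -
  let ?h = "\<lambda>s. signed_dist \<Omega> (z + s *\<^sub>R (z0 - z)) + dist z z0 * cmod (1 + of_real s * (-1))"
  have jet: "jet2 ?h (frechet_derivative (signed_dist \<Omega>) (at z) (z0 - z) + dist z z0 * Re (-1))
      (dderiv2 (signed_dist \<Omega>) z (z0 - z) (z0 - z) + dist z z0 * (Im (-1))\<^sup>2)"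
    by (intro jet2_add jet2_cmult jet2_line[OF U] jet2_cmod)
  have "?h 0 = 0" using z0(2) by simp
  moreover have "0 \<le> ?h s" for s
  proof -
    have "z0 - (z + s *\<^sub>R (z0 - z)) = (1 - s) *\<^sub>R (z0 - z)" by (simp add: algebra_simps)
    then have "dist z0 (z + s *\<^sub>R (z0 - z)) = \<bar>1 - s\<bar> * dist z z0"
      by (simp add: dist_norm norm_minus_commute)
    moreover have "signed_dist \<Omega> z0 = 0" using z0(1) abs_signed_dist[of \<Omega> z0] by simp
    moreover have "cmod (1 + of_real s * (-1)) = \<bar>1 - s\<bar>"
      by (metis (no_types) mult_minus1_right norm_of_real of_real_1 of_real_diff uminus_add_conv_diff add.commute)
    ultimately show ?thesis
      using signed_dist_Lipschitz[of \<Omega> z0 "z + s *\<^sub>R (z0 - z)"] by (simp add: mult.commute)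
  qed
  ultimately show ?thesis using jet2_local_min(1)[OF jet _ always_eventually] by simp
qed

text \<open>On the neighbourhood \<open>W\<close> the signed distance is smooth and the weight is so flat compared
  with it that \<open>r\<close> remains regular; every negative \<open>c\<close> is then admissible, and \<open>c\<^sub>0 = -1\<close> is an
  arbitrary choice. On vectors tangent to a level set of \<open>r\<close> the derivative of \<open>\<delta>\<close> is \<open>2t\<delta> (z \<bullet> v)\<close>,
  and the error permitted by Oka's inequality is cancelled exactly by the terms quadratic in
  \<open>z \<bullet> v\<close> that the weight contributes.\<close>

theorem theorem1p2:
  fixes \<Omega> :: "(complex ^ 'n::finite) set"
  assumes "open \<Omega>" and "connected \<Omega>" and "\<Omega> \<noteq> {}" and "bounded \<Omega>"
    and "smooth_boundary \<Omega>"
    and "pseudoconvex \<Omega>"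
  shows "\<forall>t::real. t > 0 \<longrightarrow>
    (\<exists>W V c\<^sub>0. open W \<and> frontier \<Omega> \<subseteq> W \<and> V = W \<inter> \<Omega> \<and> c\<^sub>0 < 0 \<and>
      (\<forall>c. c\<^sub>0 < c \<and> c < 0 \<longrightarrow>
        strongly_pseudoconvex_level_set V
          (\<lambda>z. signed_dist \<Omega> z * exp (- t * (norm z)\<^sup>2)) c))"
proof (intro allI impI)
  fix t :: real assume t: "t > 0"
  define \<delta> where "\<delta> = signed_dist \<Omega>"
  define r where "r z = \<delta> z * exp (- t * (norm z)\<^sup>2)" for z
  define W where "W = \<Union>{U. smooth_on U \<delta>} \<inter> {z. \<bar>\<delta> z\<bar> * (2 * t * norm z) < 1}"
  have cont: "continuous_on UNIV \<delta>"
    using signed_dist_Lipschitz[of \<Omega>] unfolding \<delta>_def continuous_on_iff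
    by (metis dist_real_def le_less_trans)
  have "open {z. \<bar>\<delta> z\<bar> * (2 * t * norm z) < 1}"
    by (intro open_Collect_less continuous_intros cont)
  then have "open W" by (auto simp: W_def smooth_on_def)
  have fr0: "\<delta> p = 0" if "p \<in> frontier \<Omega>" for p
    using that abs_signed_dist[of \<Omega> p] by (simp add: \<delta>_def)
  have "frontier \<Omega> \<subseteq> W"
  proof
    fix p assume p: "p \<in> frontier \<Omega>"
    obtain N where "p \<in> N" "smooth_on N \<delta>"
      using signed_dist_smooth_near_boundary[OF assms(1,5) p] unfolding \<delta>_def by blast
    then show "p \<in> W" using fr0[OF p] by (auto simp: W_def)
  qed
  have "\<Omega> \<noteq> UNIV" using assms(4) not_bounded_UNIV by blast
  then have "frontier \<Omega> \<noteq> {}" using assms(3) frontier_eq_empty by blast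
  have level: "(\<exists>U. z \<in> U \<and> smooth_on U r) \<and> regular_at r z \<and>
      (\<forall>X. X \<noteq> 0 \<and> apply_10 X r z = 0 \<longrightarrow> Re (complex_Hess r z X) > 0)" if z: "z \<in> W" "z \<in> \<Omega>" for z
  proof -
    obtain U where U: "smooth_on U \<delta>" "z \<in> U" and small: "\<bar>\<delta> z\<bar> * (2 * t * norm z) < 1"
      using z(1) by (auto simp: W_def)
    have CkU: "Ck_map k U \<delta>" "open U" for k using U(1) by (auto simp: smooth_on_def Ck_map_real)
    obtain z0 where z0: "z0 \<in> frontier \<Omega>" "infdist z (frontier \<Omega>) = dist z z0"
      using infdist_attains_inf[OF frontier_closed \<open>frontier \<Omega> \<noteq> {}\<close>] by blast
    have \<delta>z: "\<delta> z = - dist z z0" using z(2) z0(2) by (simp add: \<delta>_def signed_dist_def)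
    have "z \<noteq> z0" using z(2) z0(1) assms(1) by (auto simp: frontier_def interior_open)
    then have neg: "\<delta> z < 0" using \<delta>z by simp
    define e where "e = exp (- t * (norm z)\<^sup>2)"
    have e: "e > 0" by (simp add: e_def)
    have r_eq: "r = (\<lambda>z. \<delta> z * exp (- t * (norm z)\<^sup>2))" by (rule ext) (rule r_def)
    note wd = weighted_distance_derivatives[OF U, of t, folded r_eq e_def]
    have Ckr: "Ck_map 2 U r" using wd(1) by (simp add: smooth_on_def Ck_map_real)
    have dr: "r differentiable (at z)"
      using C2_derivatives(1)[OF Ckr U(2)] by (auto simp: differentiable_def)
    have "frechet_derivative r (at z) (z0 - z) > 0"
    proof -
      have "frechet_derivative \<delta> (at z) (z0 - z) = dist z z0"
        using signed_dist_derivative_to_nearest[OF _ CkU(2) U(2) z0(1)] CkU(1) \<delta>z by (simp add: \<delta>_def)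
      moreover have "\<bar>2 * t * \<delta> z * (z \<bullet> (z0 - z))\<bar> < dist z z0"
      proof -
        have "\<bar>2 * t * \<delta> z * (z \<bullet> (z0 - z))\<bar> = 2 * t * \<bar>\<delta> z\<bar> * \<bar>z \<bullet> (z0 - z)\<bar>"
          using t by (simp add: abs_mult)
        also have "\<dots> \<le> 2 * t * \<bar>\<delta> z\<bar> * (norm z * norm (z0 - z))"
          using t by (intro mult_left_mono Cauchy_Schwarz_ineq2) auto
        also have "\<dots> = \<bar>\<delta> z\<bar> * (2 * t * norm z) * dist z z0"
          by (simp add: dist_norm norm_minus_commute)
        also have "\<dots> < 1 * dist z z0"
          using small \<open>z \<noteq> z0\<close> by (intro mult_strict_right_mono) auto
        finally show ?thesis by simp
      qed
      ultimately show ?thesis unfolding wd(2) using e by (intro mult_pos_pos) auto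
    qed
    then have "regular_at r z" using dr by (auto simp: regular_at_def)
    moreover have "Re (complex_Hess r z X) > 0" if X: "X \<noteq> 0" "apply_10 X r z = 0" for X
    proof -
      define Y where "Y = \<i> *s X"
      have tang: "frechet_derivative \<delta> (at z) X = 2 * t * \<delta> z * (z \<bullet> X)"
        "frechet_derivative \<delta> (at z) Y = 2 * t * \<delta> z * (z \<bullet> Y)"
        using X(2) e unfolding apply_10_eq_0_iff[OF dr] wd(2) Y_def by auto
      obtain N where N: "z0 \<in> N" "smooth_on N \<delta>"
        using signed_dist_smooth_near_boundary[OF assms(1,5) z0(1)] unfolding \<delta>_def by blast
      have "dderiv2 \<delta> z X X + dderiv2 \<delta> z Y Y
          \<ge> ((frechet_derivative \<delta> (at z) X)\<^sup>2 + (frechet_derivative \<delta> (at z) Y)\<^sup>2) / \<delta> z"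
        using oka_inequality[OF assms(6) z0(1) _ \<open>z \<noteq> z0\<close> _ CkU(2) U(2) _ _ N(1), of X] CkU(1) \<delta>z N(2)
        by (auto simp: \<delta>_def Y_def smooth_on_def Ck_map_real)
      also have "((frechet_derivative \<delta> (at z) X)\<^sup>2 + (frechet_derivative \<delta> (at z) Y)\<^sup>2) / \<delta> z
          = 4 * t\<^sup>2 * \<delta> z * ((z \<bullet> X)\<^sup>2 + (z \<bullet> Y)\<^sup>2)"
        unfolding tang using neg by (simp add: field_simps power2_eq_square)
      finally have oka: "4 * t\<^sup>2 * \<delta> z * ((z \<bullet> X)\<^sup>2 + (z \<bullet> Y)\<^sup>2) \<le> dderiv2 \<delta> z X X + dderiv2 \<delta> z Y Y" .
      have "dderiv2 r z X X + dderiv2 r z Y Y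
          = e * ((dderiv2 \<delta> z X X + dderiv2 \<delta> z Y Y - 4 * t\<^sup>2 * \<delta> z * ((z \<bullet> X)\<^sup>2 + (z \<bullet> Y)\<^sup>2))
              - 2 * t * \<delta> z * (X \<bullet> X + Y \<bullet> Y))"
        unfolding wd(3) tang by (simp add: algebra_simps power2_eq_square)
      moreover have "- 2 * t * \<delta> z * (X \<bullet> X + Y \<bullet> Y) > 0"
      proof -
        have "X \<bullet> X + Y \<bullet> Y > 0" using X(1) by (intro add_pos_nonneg) auto
        then have "t * \<delta> z * (X \<bullet> X + Y \<bullet> Y) < 0" using t neg by (intro mult_neg_pos mult_pos_neg)
        then show ?thesis by simp
      qed
      \<comment> \<open>The bracket is nonnegative by Oka's inequality; what remains is the strict contribution of
        the Hessian of \<open>|z|\<^sup>2\<close>.\<close>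
      ultimately have "dderiv2 r z X X + dderiv2 r z Y Y > 0"
        using e oka by simp
      then show ?thesis by (simp add: Re_complex_Hess[OF Ckr CkU(2) U(2)] Y_def)
    qed
    ultimately show ?thesis using wd(1) U(2) by blast
  qed
  show "\<exists>W V c\<^sub>0. open W \<and> frontier \<Omega> \<subseteq> W \<and> V = W \<inter> \<Omega> \<and> c\<^sub>0 < 0 \<and>
      (\<forall>c. c\<^sub>0 < c \<and> c < 0 \<longrightarrow>
        strongly_pseudoconvex_level_set V (\<lambda>z. signed_dist \<Omega> z * exp (- t * (norm z)\<^sup>2)) c)"
    using \<open>open W\<close> \<open>frontier \<Omega> \<subseteq> W\<close> level
    unfolding strongly_pseudoconvex_level_set_def r_def[abs_def] \<delta>_def
    by (intro exI[of _ W] exI[of _ "W \<inter> \<Omega>"] exI[of _ "-1"]) auto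
qed

end
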